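(* Let $N,L\ge 1$. The algebra $Z_L(gl(N))$ of polarised traces coincides with the centraliser of the diagonal embedding of $U(gl(N))$ in $U(gl(N))^{\otimes L}$.
   Context: $gl(N)$ is the complex Lie algebra with basis $\{e_{pq}\mid 1\le p,q\le N\}$ and relations $[e_{pq},e_{rs}]=\delta_{qr}e_{ps}-\delta_{sp}e_{rq}$; $U(gl(N))$ is its universal enveloping algebra. In $U(gl(N))^{\otimes L}$, for $a\in\{1,\dots,L\}$, put $e_{pq}^{(a)}=1^{\otimes (a-1)}\otimes e_{pq}\otimes 1^{\otimes (L-a)}$. The diagonal map is the algebra homomorphism $\delta:U(gl(N))\to U(gl(N))^{\otimes L}$ with $\delta(e_{pq})=\sum_{a=1}^Le_{pq}^{(a)}$; its image is the diagonal embedding of $U(gl(N))$. The polarised traces are the elements $$T^{(a_1,\dots,a_d)}=\sum_{i_1,\dots,i_d=1}^N e_{i_2i_1}^{(a_1)}e_{i_3i_2}^{(a_2)}\cdots e_{i_1i_d}^{(a_d)},\qquad d\ge1,\ a_1,\dots,a_d\in\{1,\dots,L\},$$ and $Z_L(gl(N))$ is the subalgebra of $U(gl(N))^{\otimes L}$ generated by all polarised traces. *)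

theory Defs
  imports "HOL-Analysis.Analysis" "HOL-Library.Poly_Mapping"
begin

section \<open>Complex associative algebras\<close>

class complex_algebra = ring + monoid_mult +
  fixes cscale :: "complex \<Rightarrow> 'a \<Rightarrow> 'a"  (infixr \<open>*c\<close> 75)
  assumes cscale_add_right: "c *c (x + y) = c *c x + c *c y"
    and cscale_add_left: "(c + d) *c x = c *c x + d *c x"
    and cscale_cscale: "c *c d *c x = (c * d) *c x"
    and cscale_one: "1 *c x = x"
    and cscale_mult_left: "(c *c x) * y = c *c (x * y)"
    and cscale_mult_right: "x * (c *c y) = c *c (x * y)"

definition algebra_hom :: "('a::complex_algebra \<Rightarrow> 'b::complex_algebra) \<Rightarrow> bool" where
  "algebra_hom f \<longleftrightarrow>
     (\<forall>x y. f (x + y) = f x + f y) \<and> (\<forall>c x. f (c *c x) = c *c f x) \<and>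
     (\<forall>x y. f (x * y) = f x * f y) \<and> f 1 = 1"

inductive_set subalgebra_generated :: "'a::complex_algebra set \<Rightarrow> 'a set"
  for S :: "'a set" where
    gen: "x \<in> S \<Longrightarrow> x \<in> subalgebra_generated S"
  | one: "1 \<in> subalgebra_generated S"
  | add: "x \<in> subalgebra_generated S \<Longrightarrow> y \<in> subalgebra_generated S \<Longrightarrow>
      x + y \<in> subalgebra_generated S"
  | scale: "x \<in> subalgebra_generated S \<Longrightarrow> c *c x \<in> subalgebra_generated S"
  | mult: "x \<in> subalgebra_generated S \<Longrightarrow> y \<in> subalgebra_generated S \<Longrightarrow>
      x * y \<in> subalgebra_generated S"

definition centraliser :: "'a::complex_algebra set \<Rightarrow> 'a set" where
  "centraliser S = {x. \<forall>y\<in>S. x * y = y * x}"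

inductive_set two_sided_ideal :: "'a::ring_1 set \<Rightarrow> 'a set"
  for S :: "'a set" where
    gen: "x \<in> S \<Longrightarrow> x \<in> two_sided_ideal S"
  | zero: "0 \<in> two_sided_ideal S"
  | add: "x \<in> two_sided_ideal S \<Longrightarrow> y \<in> two_sided_ideal S \<Longrightarrow> x + y \<in> two_sided_ideal S"
  | left: "x \<in> two_sided_ideal S \<Longrightarrow> a * x \<in> two_sided_ideal S"
  | right: "x \<in> two_sided_ideal S \<Longrightarrow> x * a \<in> two_sided_ideal S"

lemma two_sided_ideal_uminus: "x \<in> two_sided_ideal S \<Longrightarrow> - x \<in> two_sided_ideal S"
  using two_sided_ideal.left[of x S "- 1"] by simp

lemma two_sided_ideal_equivp: "equivp (\<lambda>x y. x - y \<in> two_sided_ideal S)"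
proof (rule equivpI)
  show "reflp (\<lambda>x y. x - y \<in> two_sided_ideal S)"
    by (rule reflpI) (simp add: two_sided_ideal.zero)
  show "symp (\<lambda>x y. x - y \<in> two_sided_ideal S)"
    by (rule sympI) (metis minus_diff_eq two_sided_ideal_uminus)
  show "transp (\<lambda>x y. x - y \<in> two_sided_ideal S)"
  proof (rule transpI)
    fix x y z assume "x - y \<in> two_sided_ideal S" "y - z \<in> two_sided_ideal S"
    from two_sided_ideal.add[OF this] show "x - z \<in> two_sided_ideal S" by simp
  qed
qed

lemma two_sided_ideal_cong_add:
  "x - x' \<in> two_sided_ideal S \<Longrightarrow> y - y' \<in> two_sided_ideal S \<Longrightarrow>
    (x + y) - (x' + y') \<in> two_sided_ideal S"
  by (drule (1) two_sided_ideal.add) (simp add: algebra_simps)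

lemma two_sided_ideal_cong_uminus:
  "x - x' \<in> two_sided_ideal S \<Longrightarrow> (- x) - (- x') \<in> two_sided_ideal S"
  by (drule two_sided_ideal_uminus) (simp add: algebra_simps)

lemma two_sided_ideal_cong_diff:
  "x - x' \<in> two_sided_ideal S \<Longrightarrow> y - y' \<in> two_sided_ideal S \<Longrightarrow>
    (x - y) - (x' - y') \<in> two_sided_ideal S"
  using two_sided_ideal_cong_add[of x x' S "- y" "- y'"] two_sided_ideal_cong_uminus[of y y' S]
  by simp

lemma two_sided_ideal_cong_mult:
  assumes "x - x' \<in> two_sided_ideal S" "y - y' \<in> two_sided_ideal S"
  shows "x * y - x' * y' \<in> two_sided_ideal S"
proof -
  have "x * y - x' * y' = (x - x') * y + x' * (y - y')" by (simp add: algebra_simps)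
  then show ?thesis using assms by (simp add: two_sided_ideal.intros)
qed

section \<open>Monoid algebras\<close>

text \<open>The library's type \<open>'m \<Rightarrow>\<^sub>0 complex\<close> of finitely supported functions with the convolution
  product is the monoid algebra of \<open>'m\<close>; the library writes the monoid additively
  (class \<open>monoid_add\<close>), also when it is not commutative.\<close>

lemma monoid_alg_induct [case_names single sum]:
  fixes p :: "'m \<Rightarrow>\<^sub>0 'c::comm_monoid_add"
  assumes single: "\<And>m c. P (Poly_Mapping.single m c)"
    and sum: "\<And>p q. P p \<Longrightarrow> P q \<Longrightarrow> P (p + q)"
  shows "P p"
proof (induction p rule: update_induct)
  case const
  show ?case using single[of undefined 0] by simp
next
  case (update f a b)
  have "Poly_Mapping.update a b f = Poly_Mapping.single a b + f"
    using update(1)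
    by (intro poly_mapping_eqI)
      (auto simp: lookup_update lookup_add lookup_single in_keys_iff when_def)
  then show ?case using sum[OF single update(3)] by simp
qed

lemma single_scalar_central:
  fixes p :: "'m::monoid_add \<Rightarrow>\<^sub>0 complex"
  shows "p * Poly_Mapping.single 0 c = Poly_Mapping.single 0 c * p"
proof (induction p rule: monoid_alg_induct)
  case (single k v)
  then show ?case by (simp add: mult_single mult.commute)
next
  case (sum p q)
  then show ?case by (simp add: algebra_simps)
qed

definition monoid_alg_lift ::
    "('m \<Rightarrow> 'b::complex_algebra) \<Rightarrow> ('m \<Rightarrow>\<^sub>0 complex) \<Rightarrow> 'b" where
  "monoid_alg_lift \<phi> p = (\<Sum>m\<in>Poly_Mapping.keys p. Poly_Mapping.lookup p m *c \<phi> m)"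

lemma cscale_zero_left [simp]: "0 *c x = (0 :: 'a::complex_algebra)"
  using cscale_add_left[of 0 0 x] by simp

lemma cscale_zero_right [simp]: "c *c 0 = (0 :: 'a::complex_algebra)"
  using cscale_add_right[of c 0 "0::'a"] by simp

lemma cscale_minus_one: "(- 1) *c x = - (x :: 'a::complex_algebra)"
  using cscale_add_left[of "- 1" 1 x] by (simp add: cscale_one eq_neg_iff_add_eq_0)

lemma cscale_sum_right: "c *c (\<Sum>i\<in>I. f i) = (\<Sum>i\<in>I. c *c (f i :: 'a::complex_algebra))"
  by (induction I rule: infinite_finite_induct) (simp_all add: cscale_add_right)

lemma monoid_alg_lift_superset:
  assumes "finite A" "Poly_Mapping.keys p \<subseteq> A"
  shows "monoid_alg_lift \<phi> p = (\<Sum>m\<in>A. Poly_Mapping.lookup p m *c \<phi> m)"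
  unfolding monoid_alg_lift_def
  by (rule sum.mono_neutral_left) (use assms in \<open>auto simp: in_keys_iff\<close>)

lemma monoid_alg_lift_add:
  "monoid_alg_lift \<phi> (p + q) = monoid_alg_lift \<phi> p + monoid_alg_lift \<phi> q"
proof -
  let ?A = "Poly_Mapping.keys p \<union> Poly_Mapping.keys q"
  have "Poly_Mapping.keys (p + q) \<subseteq> ?A" by (rule Poly_Mapping.keys_add)
  then show ?thesis
    by (simp add: monoid_alg_lift_superset[of ?A] lookup_add cscale_add_left sum.distrib)
qed

lemma monoid_alg_lift_zero: "monoid_alg_lift \<phi> 0 = 0"
  by (simp add: monoid_alg_lift_def)

lemma monoid_alg_lift_single: "monoid_alg_lift \<phi> (Poly_Mapping.single m c) = c *c \<phi> m"
  by (simp add: monoid_alg_lift_def)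

lemma monoid_alg_lift_uminus: "monoid_alg_lift \<phi> (- p) = - monoid_alg_lift \<phi> p"
  using monoid_alg_lift_add[of \<phi> p "- p"]
  by (simp add: monoid_alg_lift_zero eq_neg_iff_add_eq_0 add.commute)

lemma monoid_alg_lift_diff:
  "monoid_alg_lift \<phi> (p - q) = monoid_alg_lift \<phi> p - monoid_alg_lift \<phi> q"
  using monoid_alg_lift_add[of \<phi> p "- q"] by (simp add: monoid_alg_lift_uminus)

lemma monoid_alg_lift_mult:
  assumes "\<And>m n. \<phi> (m + n) = \<phi> m * \<phi> n"
  shows "monoid_alg_lift \<phi> (p * q) = monoid_alg_lift \<phi> p * monoid_alg_lift \<phi> q"
proof (induction p rule: monoid_alg_induct)
  case (single k v)
  show ?case
  proof (induction q rule: monoid_alg_induct)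
    case (single k' v')
    then show ?case
      by (simp add: mult_single monoid_alg_lift_single assms cscale_mult_left cscale_mult_right
          cscale_cscale mult.commute)
  next
    case (sum p q)
    then show ?case by (simp add: distrib_left monoid_alg_lift_add)
  qed
next
  case (sum p q)
  then show ?case by (simp add: distrib_right monoid_alg_lift_add)
qed

lemma monoid_alg_lift_ideal:
  assumes "\<And>m n. \<phi> (m + n) = \<phi> m * \<phi> n" "\<And>r. r \<in> S \<Longrightarrow> monoid_alg_lift \<phi> r = 0"
    and "p \<in> two_sided_ideal S"
  shows "monoid_alg_lift \<phi> p = 0"
  using assms(3)
  by (induction rule: two_sided_ideal.induct)
    (simp_all add: assms monoid_alg_lift_zero monoid_alg_lift_add monoid_alg_lift_mult)

section \<open>The Lie algebra gl(N) and its universal enveloping algebra\<close>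

text \<open>gl(N) is the Lie algebra of complex matrices with the commutator bracket, with rows and
  columns indexed by a finite type \<open>'n\<close> with N elements.\<close>

type_synonym 'n gl = "complex ^ 'n ^ 'n"

definition gl_scale :: "complex \<Rightarrow> 'n::finite gl \<Rightarrow> 'n gl" where
  "gl_scale c A = (\<chi> i j. c * A $ i $ j)"

definition gl_bracket :: "'n::finite gl \<Rightarrow> 'n gl \<Rightarrow> 'n gl" where
  "gl_bracket A B = A ** B - B ** A"

definition gl_unit :: "'n::finite \<Rightarrow> 'n \<Rightarrow> 'n gl" where
  "gl_unit p q = (\<chi> i j. if i = p \<and> j = q then 1 else 0)"

lemma gl_bracket_gl_unit:
  "gl_bracket (gl_unit p q) (gl_unit r s) =
    (if q = r then gl_unit p s else 0) - (if s = p then gl_unit r q else 0)"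
proof -
  have "gl_unit p q ** gl_unit r s = (if q = r then gl_unit p s else 0)" for p q r s :: 'a
  proof -
    have "(\<Sum>k\<in>UNIV. (if i = p \<and> k = q then 1 else 0) * (if k = r \<and> j = s then 1 else 0)) =
        (if q = r \<and> i = p \<and> j = s then 1 else (0::complex))" for i j
    proof -
      have "(\<Sum>k\<in>UNIV. (if i = p \<and> k = q then 1 else 0) * (if k = r \<and> j = s then 1 else 0)) =
        (\<Sum>k\<in>UNIV. if k = q then (if q = r \<and> i = p \<and> j = s then 1 else (0::complex)) else 0)"
        by (rule sum.cong) auto
      then show ?thesis by simp
    qed
    then show ?thesis
      by (auto simp: gl_unit_def matrix_matrix_mult_def vec_eq_iff)
  qed
  then show ?thesis unfolding gl_bracket_def by auto
qed

lemma gl_expand: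
  "A = (\<Sum>p\<in>UNIV. \<Sum>q\<in>UNIV. gl_scale (A $ p $ q) (gl_unit p q))"
proof -
  have "(\<Sum>p\<in>UNIV. \<Sum>q\<in>UNIV. A $ p $ q * (if i = p \<and> j = q then 1 else 0)) = A $ i $ j" for i j
  proof -
    have "(\<Sum>q\<in>UNIV. A $ p $ q * (if i = p \<and> j = q then 1 else 0)) =
        (if p = i then A $ i $ j else 0)" for p
    proof -
      have "(\<Sum>q\<in>UNIV. A $ p $ q * (if i = p \<and> j = q then 1 else 0)) =
        (\<Sum>q\<in>UNIV. if q = j then (if p = i then A $ i $ j else 0) else 0)"
        by (rule sum.cong) auto
      then show ?thesis by simp
    qed
    then show ?thesis by simp
  qed
  then show ?thesis by (simp add: vec_eq_iff gl_scale_def gl_unit_def)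
qed

text \<open>Words, with concatenation as addition: their monoid algebra is the free associative
  algebra.\<close>

datatype 'a free_mon = Word (letters: "'a list")

instantiation free_mon :: (type) monoid_add
begin
definition "0 = Word []"
definition "u + v = Word (letters u @ letters v)"
instance by standard (simp_all add: zero_free_mon_def plus_free_mon_def)
end

definition free_gen :: "'a \<Rightarrow> 'a free_mon \<Rightarrow>\<^sub>0 complex" where
  "free_gen x = Poly_Mapping.single (Word [x]) 1"

text \<open>U(gl(N)) is the tensor algebra of gl(N) modulo \<open>x \<otimes> y - y \<otimes> x - [x, y]\<close>. The tensor algebra
  is itself the free algebra on the set gl(N) modulo linearity of the generators, which gives the
  first two families.\<close>

definition ugl_rels :: "('n::finite gl free_mon \<Rightarrow>\<^sub>0 complex) set" where
  "ugl_rels =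
     {free_gen (x + y) - free_gen x - free_gen y | x y. True} \<union>
     {free_gen (gl_scale c x) - Poly_Mapping.single 0 c * free_gen x | c x. True} \<union>
     {free_gen x * free_gen y - free_gen y * free_gen x - free_gen (gl_bracket x y) | x y. True}"

quotient_type (overloaded) 'n ugl = "'n::finite gl free_mon \<Rightarrow>\<^sub>0 complex"
  / "\<lambda>u v. u - v \<in> two_sided_ideal ugl_rels"
  by (rule two_sided_ideal_equivp)

instantiation ugl :: (finite) complex_algebra
begin
lift_definition zero_ugl :: "'a ugl" is 0 .
lift_definition one_ugl :: "'a ugl" is 1 .
lift_definition plus_ugl :: "'a ugl \<Rightarrow> 'a ugl \<Rightarrow> 'a ugl" is "(+)"
  by (rule two_sided_ideal_cong_add)
lift_definition uminus_ugl :: "'a ugl \<Rightarrow> 'a ugl" is uminus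
  by (rule two_sided_ideal_cong_uminus)
lift_definition minus_ugl :: "'a ugl \<Rightarrow> 'a ugl \<Rightarrow> 'a ugl" is "(-)"
  by (rule two_sided_ideal_cong_diff)
lift_definition times_ugl :: "'a ugl \<Rightarrow> 'a ugl \<Rightarrow> 'a ugl" is "(*)"
  by (rule two_sided_ideal_cong_mult)
lift_definition cscale_ugl :: "complex \<Rightarrow> 'a ugl \<Rightarrow> 'a ugl"
  is "\<lambda>c u. Poly_Mapping.single 0 c * u"
  by (rule two_sided_ideal_cong_mult) (simp_all add: two_sided_ideal.zero)
instance
proof
  fix x y z :: "'a ugl" and c d :: complex
  note * = two_sided_ideal.zero algebra_simps
  show "x + y + z = x + (y + z)" by transfer (simp add: *)
  show "x + y = y + x" by transfer (simp add: *)
  show "0 + x = x" by transfer (simp add: *)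
  show "- x + x = 0" by transfer (simp add: *)
  show "x - y = x + - y" by transfer (simp add: *)
  show "x * y * z = x * (y * z)" by transfer (simp add: *)
  show "(x + y) * z = x * z + y * z" by transfer (simp add: *)
  show "x * (y + z) = x * y + x * z" by transfer (simp add: *)
  show "1 * x = x" by transfer (simp add: *)
  show "x * 1 = x" by transfer (simp add: *)
  show "c *c (x + y) = c *c x + c *c y" by transfer (simp add: *)
  show "(c + d) *c x = c *c x + d *c x" by transfer (simp add: * single_add)
  show "c *c d *c x = (c * d) *c x"
    by transfer (simp add: two_sided_ideal.zero mult_single mult.assoc[symmetric])
  show "1 *c x = x" by transfer (simp add: *)
  show "(c *c x) * y = c *c (x * y)" by transfer (simp add: *)
  show "x * (c *c y) = c *c (x * y)"
    by transfer (simp add: two_sided_ideal.zero mult.assoc[symmetric] single_scalar_central)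
qed
end

lift_definition ugl_of :: "'n::finite gl \<Rightarrow> 'n ugl" is free_gen .

lemma ugl_of_add: "ugl_of (x + y) = ugl_of x + ugl_of y"
  by transfer (rule two_sided_ideal.gen, unfold ugl_rels_def diff_diff_eq[symmetric], blast)

lemma ugl_of_scale: "ugl_of (gl_scale c x) = c *c ugl_of x"
  by transfer (rule two_sided_ideal.gen, unfold ugl_rels_def, blast)

lemma ugl_of_bracket: "ugl_of (gl_bracket x y) = ugl_of x * ugl_of y - ugl_of y * ugl_of x"
proof -
  have "ugl_of x * ugl_of y - ugl_of y * ugl_of x = ugl_of (gl_bracket x y)"
    by transfer (rule two_sided_ideal.gen, unfold ugl_rels_def, blast)
  then show ?thesis ..
qed

lemma ugl_of_zero: "ugl_of 0 = 0"
  using ugl_of_add[of 0 0] by simp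

lemma ugl_of_sum: "ugl_of (\<Sum>i\<in>I. f i) = (\<Sum>i\<in>I. ugl_of (f i))"
  by (induction I rule: infinite_finite_induct) (simp_all add: ugl_of_zero ugl_of_add)

definition ugl_e :: "'n::finite \<Rightarrow> 'n \<Rightarrow> 'n ugl" where
  "ugl_e p q = ugl_of (gl_unit p q)"

lemma ugl_of_expand: "ugl_of A = (\<Sum>p\<in>UNIV. \<Sum>q\<in>UNIV. (A $ p $ q) *c ugl_e p q)"
  by (subst gl_expand) (simp add: ugl_of_sum ugl_of_scale ugl_e_def)

lemma ugl_e_commutator:
  "ugl_e p q * ugl_e r s - ugl_e r s * ugl_e p q =
    (if q = r then ugl_e p s else 0) - (if s = p then ugl_e r q else 0)"
proof -
  have "ugl_of (x - y) = ugl_of x - ugl_of y" for x y :: "'a gl"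
    using ugl_of_add[of "x - y" y] by simp
  then show ?thesis
    unfolding ugl_e_def ugl_of_bracket[symmetric] gl_bracket_gl_unit
    by (simp add: ugl_of_zero)
qed

lemma ugl_induct [case_names one e add scale mult]:
  fixes x :: "'n::finite ugl"
  assumes one: "P 1"
    and e: "\<And>p q. P (ugl_e p q)"
    and add: "\<And>x y. P x \<Longrightarrow> P y \<Longrightarrow> P (x + y)"
    and scale: "\<And>c x. P x \<Longrightarrow> P (c *c x)"
    and mult: "\<And>x y. P x \<Longrightarrow> P y \<Longrightarrow> P (x * y)"
  shows "P x"
proof -
  have zero: "P 0" using scale[of 1 0] one by simp
  have sum: "P (\<Sum>i\<in>I. f i)" if "\<And>i. P (f i)" for I and f :: "'n \<Rightarrow> 'n ugl"
    by (induction I rule: infinite_finite_induct) (simp_all add: zero add that)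
  have of: "P (ugl_of A)" for A by (simp add: ugl_of_expand sum scale e)
  have word: "P (abs_ugl (Poly_Mapping.single (Word xs) 1))" for xs
  proof (induction xs)
    case Nil
    have "abs_ugl (Poly_Mapping.single (Word []) 1) = (1 :: 'n ugl)"
      unfolding one_ugl_def by (simp add: zero_free_mon_def[symmetric])
    then show ?case by (simp add: one)
  next
    case (Cons A xs)
    have "abs_ugl (Poly_Mapping.single (Word (A # xs)) 1) =
        ugl_of A * abs_ugl (Poly_Mapping.single (Word xs) 1)"
      by (simp add: ugl_of.abs_eq times_ugl.abs_eq free_gen_def mult_single plus_free_mon_def)
    then show ?case by (simp add: of mult Cons)
  qed
  have "P (abs_ugl p)" for p
  proof (induction p rule: monoid_alg_induct)
    case (single k v)
    have "abs_ugl (Poly_Mapping.single k v) = v *c abs_ugl (Poly_Mapping.single k 1)"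
      by (simp add: cscale_ugl.abs_eq mult_single)
    then show ?case using word[of "letters k"] by (simp add: scale)
  next
    case (sum p q)
    have "abs_ugl (p + q) = abs_ugl p + abs_ugl q" by (simp add: plus_ugl.abs_eq)
    then show ?case by (simp add: add sum)
  qed
  then show ?thesis by (metis Quotient3_abs_rep[OF Quotient3_ugl])
qed

lemma ugl_hom_exists:
  fixes g :: "'n::finite gl \<Rightarrow> 'b::complex_algebra"
  assumes add: "\<And>x y. g (x + y) = g x + g y"
    and scale: "\<And>c x. g (gl_scale c x) = c *c g x"
    and bracket: "\<And>x y. g (gl_bracket x y) = g x * g y - g y * g x"
  shows "\<exists>f. algebra_hom f \<and> (\<forall>x. f (ugl_of x) = g x)"
proof -
  define \<phi> where "\<phi> w = prod_list (map g (letters w))" for w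
  have \<phi>_add: "\<phi> (v + w) = \<phi> v * \<phi> w" for v w
    by (simp add: \<phi>_def plus_free_mon_def)
  have \<phi>_zero: "\<phi> 0 = 1" by (simp add: \<phi>_def zero_free_mon_def)
  let ?F = "monoid_alg_lift \<phi>"
  note lift = monoid_alg_lift_add monoid_alg_lift_diff monoid_alg_lift_single
    monoid_alg_lift_mult[where \<phi> = \<phi>, OF \<phi>_add]
  have F_gen: "?F (free_gen x) = g x" for x
    by (simp add: free_gen_def lift \<phi>_def cscale_one)
  have F_scale: "?F (Poly_Mapping.single 0 c * p) = c *c ?F p" for c p
    by (simp add: lift \<phi>_zero cscale_mult_left)
  have "?F r = 0" if "r \<in> ugl_rels" for r
    using that unfolding ugl_rels_def
    by (auto simp: F_gen lift add scale bracket \<phi>_zero cscale_mult_left)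
  then have F_ideal: "?F p = 0" if "p \<in> two_sided_ideal ugl_rels" for p
    using that monoid_alg_lift_ideal[where \<phi> = \<phi>, OF \<phi>_add] by blast
  define f where "f x = ?F (rep_ugl x)" for x
  have f_abs: "f (abs_ugl p) = ?F p" for p
  proof -
    have "rep_ugl (abs_ugl p) - p \<in> two_sided_ideal ugl_rels"
      using rep_abs_rsp_left[OF Quotient3_ugl, of p p] by (simp add: two_sided_ideal.zero)
    from F_ideal[OF this] show ?thesis by (simp add: f_def lift(2))
  qed
  have abs: "\<exists>p. x = abs_ugl p" for x :: "'n ugl"
    by (metis Quotient3_abs_rep[OF Quotient3_ugl])
  have "algebra_hom f"
    unfolding algebra_hom_def
  proof (intro conjI allI)
    fix x y :: "'n ugl" and c
    obtain p q where [simp]: "x = abs_ugl p" "y = abs_ugl q" using abs by blast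
    show "f (x + y) = f x + f y"
      by (simp add: plus_ugl.abs_eq f_abs lift)
    show "f (x * y) = f x * f y"
      by (simp add: times_ugl.abs_eq f_abs lift)
    show "f (c *c x) = c *c f x"
      by (simp add: cscale_ugl.abs_eq f_abs F_scale)
    show "f 1 = 1"
      using lift(3)[of \<phi> 0 1] by (simp add: one_ugl_def f_abs \<phi>_zero cscale_one)
  qed
  moreover have "f (ugl_of x) = g x" for x
    by (simp add: ugl_of.abs_eq f_abs F_gen)
  ultimately show ?thesis by blast
qed

section \<open>Tensor powers of algebras\<close>

text \<open>The monoid algebra of the multiplicative monoid of families \<open>'l \<Rightarrow> 'a\<close> has the families
  (formal pure tensors) as a basis, multiplied factorwise; its quotient by the multilinearity
  relations is the tensor power \<open>A\<^sup>\<otimes>\<^sup>L\<close>, with tensor factors indexed by \<open>'l\<close>. A product of a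
  multilinearity relation with a basis element is again such a relation, so the ideal generated
  by these relations is just their linear span.\<close>

datatype ('l, 'a) family = Family (factor: "'l \<Rightarrow> 'a")

instantiation family :: (type, monoid_mult) monoid_add
begin
definition "0 = Family (\<lambda>_. 1)"
definition "u + v = Family (\<lambda>i. factor u i * factor v i)"
instance by standard (simp_all add: zero_family_def plus_family_def mult.assoc)
end

definition formal_tensor :: "('l \<Rightarrow> 'a::complex_algebra) \<Rightarrow> ('l, 'a) family \<Rightarrow>\<^sub>0 complex" where
  "formal_tensor f = Poly_Mapping.single (Family f) 1"

definition multilinear_rels :: "(('l::finite, 'a::complex_algebra) family \<Rightarrow>\<^sub>0 complex) set" where
  "multilinear_rels =
     {formal_tensor (f(a := x + y)) - formal_tensor (f(a := x)) - formal_tensor (f(a := y))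
       | f a x y. True} \<union>
     {formal_tensor (f(a := c *c x)) - Poly_Mapping.single 0 c * formal_tensor (f(a := x))
       | f a c x. True}"

quotient_type (overloaded) ('l, 'a) tensor_power =
    "('l::finite, 'a::complex_algebra) family \<Rightarrow>\<^sub>0 complex"
  / "\<lambda>u v. u - v \<in> two_sided_ideal multilinear_rels"
  by (rule two_sided_ideal_equivp)

instantiation tensor_power :: (finite, complex_algebra) complex_algebra
begin
lift_definition zero_tensor_power :: "('a, 'b) tensor_power" is 0 .
lift_definition one_tensor_power :: "('a, 'b) tensor_power" is 1 .
lift_definition plus_tensor_power ::
    "('a, 'b) tensor_power \<Rightarrow> ('a, 'b) tensor_power \<Rightarrow> ('a, 'b) tensor_power" is "(+)"
  by (rule two_sided_ideal_cong_add)
lift_definition uminus_tensor_power :: "('a, 'b) tensor_power \<Rightarrow> ('a, 'b) tensor_power" is uminus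
  by (rule two_sided_ideal_cong_uminus)
lift_definition minus_tensor_power ::
    "('a, 'b) tensor_power \<Rightarrow> ('a, 'b) tensor_power \<Rightarrow> ('a, 'b) tensor_power" is "(-)"
  by (rule two_sided_ideal_cong_diff)
lift_definition times_tensor_power ::
    "('a, 'b) tensor_power \<Rightarrow> ('a, 'b) tensor_power \<Rightarrow> ('a, 'b) tensor_power" is "(*)"
  by (rule two_sided_ideal_cong_mult)
lift_definition cscale_tensor_power ::
    "complex \<Rightarrow> ('a, 'b) tensor_power \<Rightarrow> ('a, 'b) tensor_power"
  is "\<lambda>c u. Poly_Mapping.single 0 c * u"
  by (rule two_sided_ideal_cong_mult) (simp_all add: two_sided_ideal.zero)
instance
proof
  fix x y z :: "('a, 'b) tensor_power" and c d :: complex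
  note * = two_sided_ideal.zero algebra_simps
  show "x + y + z = x + (y + z)" by transfer (simp add: *)
  show "x + y = y + x" by transfer (simp add: *)
  show "0 + x = x" by transfer (simp add: *)
  show "- x + x = 0" by transfer (simp add: *)
  show "x - y = x + - y" by transfer (simp add: *)
  show "x * y * z = x * (y * z)" by transfer (simp add: *)
  show "(x + y) * z = x * z + y * z" by transfer (simp add: *)
  show "x * (y + z) = x * y + x * z" by transfer (simp add: *)
  show "1 * x = x" by transfer (simp add: *)
  show "x * 1 = x" by transfer (simp add: *)
  show "c *c (x + y) = c *c x + c *c y" by transfer (simp add: *)
  show "(c + d) *c x = c *c x + d *c x" by transfer (simp add: * single_add)
  show "c *c d *c x = (c * d) *c x"
    by transfer (simp add: two_sided_ideal.zero mult_single mult.assoc[symmetric])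
  show "1 *c x = x" by transfer (simp add: *)
  show "(c *c x) * y = c *c (x * y)" by transfer (simp add: *)
  show "x * (c *c y) = c *c (x * y)"
    by transfer (simp add: two_sided_ideal.zero mult.assoc[symmetric] single_scalar_central)
qed
end

lift_definition pure_tensor ::
  "('l::finite \<Rightarrow> 'a::complex_algebra) \<Rightarrow> ('l, 'a) tensor_power" is formal_tensor .

lemma pure_tensor_add:
  "pure_tensor (f(a := x + y)) = pure_tensor (f(a := x)) + pure_tensor (f(a := y))"
  by transfer (rule two_sided_ideal.gen, unfold multilinear_rels_def diff_diff_eq[symmetric], blast)

lemma pure_tensor_scale: "pure_tensor (f(a := c *c x)) = c *c pure_tensor (f(a := x))"
  by transfer (rule two_sided_ideal.gen, unfold multilinear_rels_def, blast)

lemma pure_tensor_mult: "pure_tensor f * pure_tensor g = pure_tensor (\<lambda>i. f i * g i)"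
  by transfer (simp add: formal_tensor_def mult_single plus_family_def two_sided_ideal.zero)

lemma pure_tensor_one: "pure_tensor (\<lambda>_. 1) = 1"
  by transfer (simp add: formal_tensor_def zero_family_def[symmetric] two_sided_ideal.zero)

text \<open>\<open>at_factor a x\<close> is \<open>1 \<otimes> \<dots> \<otimes> x \<otimes> \<dots> \<otimes> 1\<close> with \<open>x\<close> in the tensor factor \<open>a\<close>.\<close>

definition at_factor :: "'l::finite \<Rightarrow> 'a::complex_algebra \<Rightarrow> ('l, 'a) tensor_power" where
  "at_factor a x = pure_tensor ((\<lambda>_. 1)(a := x))"

lemma at_factor_hom: "algebra_hom (at_factor a)"
proof -
  have "(\<lambda>_. 1)(a := 1) = (\<lambda>_. 1 :: 'a)" by auto
  then show ?thesis
    unfolding algebra_hom_def at_factor_def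
    by (auto simp: pure_tensor_add pure_tensor_scale pure_tensor_mult pure_tensor_one
        intro!: arg_cong[of _ _ pure_tensor])
qed

lemma at_factor_commute: "a \<noteq> b \<Longrightarrow> at_factor a x * at_factor b y = at_factor b y * at_factor a x"
  by (auto simp: at_factor_def pure_tensor_mult intro!: arg_cong[of _ _ pure_tensor])

section \<open>The diagonal map and the polarised traces\<close>

definition diagonal :: "'n::finite ugl \<Rightarrow> ('l::finite, 'n ugl) tensor_power" where
  "diagonal = (THE \<delta>. algebra_hom \<delta> \<and>
     (\<forall>p q. \<delta> (ugl_e p q) = (\<Sum>a\<in>UNIV. at_factor a (ugl_e p q))))"

lemma diagonal_ex1:
  "\<exists>!\<delta> :: 'n::finite ugl \<Rightarrow> ('l::finite, 'n ugl) tensor_power. algebra_hom \<delta> \<and>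
     (\<forall>p q. \<delta> (ugl_e p q) = (\<Sum>a\<in>UNIV. at_factor a (ugl_e p q)))"
proof (rule ex_ex1I)
  define g :: "'n gl \<Rightarrow> ('l, 'n ugl) tensor_power"
    where "g x = (\<Sum>a\<in>UNIV. at_factor a (ugl_of x))" for x
  have at: "at_factor a (x + y) = at_factor a x + at_factor a y"
    "at_factor a (c *c x) = c *c at_factor a x"
    "at_factor a (x * y) = at_factor a x * at_factor a y" for a :: 'l and c and x y :: "'n ugl"
    using at_factor_hom[of a] unfolding algebra_hom_def by auto
  have at_diff: "at_factor a (x - y) = at_factor a x - at_factor a y"
    for a :: 'l and x y :: "'n ugl"
    using at(1)[of a "x - y" y] by simp
  have "\<exists>f. algebra_hom f \<and> (\<forall>x. f (ugl_of x) = g x)"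
  proof (rule ugl_hom_exists)
    show "g (x + y) = g x + g y" for x y
      by (simp add: g_def ugl_of_add at sum.distrib)
    show "g (gl_scale c x) = c *c g x" for c x
      by (simp add: g_def ugl_of_scale at cscale_sum_right)
    show "g (gl_bracket x y) = g x * g y - g y * g x" for x y
    proof -
      let ?x = "\<lambda>a::'l. at_factor a (ugl_of x)" and ?y = "\<lambda>a::'l. at_factor a (ugl_of y)"
      have eq: "?x a * ?y b - ?y b * ?x a = (if b = a then ?x a * ?y a - ?y a * ?x a else 0)"
        for a b by (simp add: at_factor_commute)
      have inner: "(\<Sum>b\<in>UNIV. ?x a * ?y b - ?y b * ?x a) = ?x a * ?y a - ?y a * ?x a" for a
        by (rule trans[OF sum.cong[OF refl eq]]) simp
      have "g y * g x = (\<Sum>a\<in>UNIV. \<Sum>b\<in>UNIV. ?y b * ?x a)"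
        unfolding g_def sum_product by (rule sum.swap)
      moreover have "g x * g y = (\<Sum>a\<in>UNIV. \<Sum>b\<in>UNIV. ?x a * ?y b)"
        unfolding g_def sum_product ..
      ultimately have
        "g x * g y - g y * g x = (\<Sum>a\<in>UNIV. \<Sum>b\<in>UNIV. ?x a * ?y b - ?y b * ?x a)"
        by (simp only: sum_subtractf)
      also have "\<dots> = (\<Sum>a\<in>UNIV. ?x a * ?y a - ?y a * ?x a)"
        by (simp only: inner)
      also have "\<dots> = g (gl_bracket x y)"
        by (simp add: g_def ugl_of_bracket at at_diff)
      finally show ?thesis ..
    qed
  qed
  then show "\<exists>\<delta> :: 'n ugl \<Rightarrow> ('l, 'n ugl) tensor_power. algebra_hom \<delta> \<and>
     (\<forall>p q. \<delta> (ugl_e p q) = (\<Sum>a\<in>UNIV. at_factor a (ugl_e p q)))"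
    unfolding g_def ugl_e_def by blast
next
  fix \<delta> \<delta>' :: "'n ugl \<Rightarrow> ('l, 'n ugl) tensor_power"
  assume *: "algebra_hom \<delta> \<and> (\<forall>p q. \<delta> (ugl_e p q) = (\<Sum>a\<in>UNIV. at_factor a (ugl_e p q)))"
    "algebra_hom \<delta>' \<and> (\<forall>p q. \<delta>' (ugl_e p q) = (\<Sum>a\<in>UNIV. at_factor a (ugl_e p q)))"
  have "\<delta> x = \<delta>' x" for x
    using * by (induction x rule: ugl_induct) (simp_all add: algebra_hom_def)
  then show "\<delta> = \<delta>'" by blast
qed

lemma diagonal_hom: "algebra_hom diagonal"
  and diagonal_ugl_e: "diagonal (ugl_e p q) = (\<Sum>a\<in>UNIV. at_factor a (ugl_e p q))"
  using theI'[OF diagonal_ex1] unfolding diagonal_def by blast+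

text \<open>For \<open>as = [a\<^sub>1, \<dots>, a\<^sub>d]\<close> the sum runs over the index lists \<open>is = [i\<^sub>1, \<dots>, i\<^sub>d]\<close> (counted from 0
  here), with cyclic convention \<open>i\<^sub>d\<^sub>+\<^sub>1 = i\<^sub>1\<close>; \<open>prod_list\<close> multiplies from left to right.\<close>

definition polarised_trace :: "'l::finite list \<Rightarrow> ('l, 'n::finite ugl) tensor_power" where
  "polarised_trace as =
     (\<Sum>is | length is = length as.
        prod_list (map (\<lambda>k. at_factor (as ! k) (ugl_e (is ! (Suc k mod length as)) (is ! k)))
          [0..<length as]))"

definition polarised_trace_algebra :: "('l::finite, 'n::finite ugl) tensor_power set" where
  "polarised_trace_algebra = subalgebra_generated {polarised_trace as | as. as \<noteq> []}"

end

theory Submission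
  imports Defs
begin

text \<open>
  Write \<open>E\<^sub>p\<^sub>q\<^sup>a\<close> for \<open>e\<^sub>p\<^sub>q\<close> in the tensor factor \<open>a\<close>. The words of length at most \<open>d\<close> in these letters
  span a finite-dimensional space on which gl(N) acts by derivations, and the coefficient functions
  of such words carry the standard Hermitian form, for which \<open>e\<^sub>r\<^sub>s\<close> and \<open>e\<^sub>s\<^sub>r\<close> are adjoint. Let \<open>x\<close>
  commute with the diagonal, and let \<open>t\<close> be the coefficient function of \<open>x\<close> made orthogonal to the
  space \<open>K\<close> of all coefficient functions whose value lies in the algebra of polarised traces. Since
  \<open>e\<^sub>r\<^sub>s t\<close> has value 0, it lies in \<open>K\<close>, and so does \<open>e\<^sub>s\<^sub>r e\<^sub>r\<^sub>s t\<close>; hence \<open>\<parallel>e\<^sub>r\<^sub>s t\<parallel>\<^sup>2 = \<langle>t, e\<^sub>s\<^sub>r e\<^sub>r\<^sub>s t\<rangle> = 0\<close>, so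
  \<open>t\<close> is invariant.

  It remains to see that an invariant \<open>t\<close> orthogonal to \<open>K\<close> vanishes. A sum of words in which the row
  indices are a permutation of the column indices has its value in the algebra of polarised traces:
  exchanging two adjacent letters changes it by such sums of smaller length, and a suitable
  order of the letters exhibits the cycles of the permutation as polarised traces. So \<open>t\<close> is an
  invariant tensor orthogonal to all permutation tensors. Contracting a row with a column index
  preserves both properties, so by induction all contractions vanish; but on a traceless invariant
  tensor the Casimir element of the action on the column indices acts as 0, which by positivity
  makes the tensor invariant under the action on the column indices alone, and there the identity
  matrix acts by the degree.
\<close>

section \<open>Orthogonal projection\<close>

text \<open>The form only sees the values on \<open>S\<close>, so it is degenerate on functions and
  the projection is built by induction on \<open>S\<close>: the functions in \<open>K\<close> that
  vanish at the new point \<open>s\<close> form a subspace \<open>K'\<close>, and at most one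
  further direction is missing.\<close>

lemma orthogonal_projection_exists:
  fixes K :: "('i \<Rightarrow> complex) set"
  assumes "finite S" and zero: "(\<lambda>_. 0) \<in> K"
    and add: "\<And>f g. f \<in> K \<Longrightarrow> g \<in> K \<Longrightarrow> (\<lambda>x. f x + g x) \<in> K"
    and scale: "\<And>c f. f \<in> K \<Longrightarrow> (\<lambda>x. c * f x) \<in> K"
  shows "\<exists>k\<in>K. \<forall>k'\<in>K. (\<Sum>x\<in>S. (t x - k x) * cnj (k' x)) = 0"
  using assms
proof (induction S arbitrary: K t rule: finite_induct)
  case empty
  then show ?case by auto
next
  case (insert s S)
  note zero = insert.prems(1) and add = insert.prems(2) and scale = insert.prems(3)
  define K' where "K' = {k \<in> K. k s = 0}"
  have IH: "\<exists>k\<in>K'. \<forall>k'\<in>K'. (\<Sum>x\<in>S. (t x - k x) * cnj (k' x)) = 0" for t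
    by (rule insert.IH) (auto simp: K'_def zero add scale)
  have sum_insert: "(\<Sum>x\<in>insert s S. f x) = f s + (\<Sum>x\<in>S. f x)" for f :: "'i \<Rightarrow> complex"
    using insert.hyps by simp
  obtain k1 where k1: "k1 \<in> K'" "\<And>k'. k' \<in> K' \<Longrightarrow> (\<Sum>x\<in>S. (t x - k1 x) * cnj (k' x)) = 0"
    using IH[of t] by blast
  show ?case
  proof (cases "K' = K")
    case True
    then have "k' s = 0" if "k' \<in> K" for k'
      using that unfolding K'_def by blast
    then show ?thesis using k1 True by (intro bexI[of _ k1]) (auto simp: sum_insert)
  next
    case False
    then obtain w where w: "w \<in> K" "w s \<noteq> 0" unfolding K'_def by blast
    obtain k0 where k0: "k0 \<in> K'" "\<And>k'. k' \<in> K' \<Longrightarrow> (\<Sum>x\<in>S. (w x - k0 x) * cnj (k' x)) = 0"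
      using IH[of w] by blast
    \<comment> \<open>\<open>u\<close> is \<open>w\<close> made orthogonal to \<open>K'\<close>.
      Since \<open>u s\<close> is nonzero, \<open>K\<close> is spanned by \<open>K'\<close> and
      \<open>u\<close>, and it remains to correct \<open>k1\<close> along \<open>u\<close>.\<close>
    define u where "u x = w x - k0 x" for x
    have u: "u \<in> K" "u s \<noteq> 0"
      using add[OF w(1) scale[of k0 "-1"]] k0(1) w(2) by (auto simp: u_def[abs_def] K'_def)
    define ip where "ip f g = (\<Sum>x\<in>insert s S. f x * cnj (g x))" for f g :: "'i \<Rightarrow> complex"
    have ip_u: "ip u k' = 0" if "k' \<in> K'" for k'
      using k0(2)[OF that] that by (simp add: ip_def sum_insert u_def K'_def)
    have "ip u u = of_real (\<Sum>x\<in>insert s S. (cmod (u x))\<^sup>2)"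
      by (simp only: ip_def complex_norm_square of_real_sum)
    moreover have "(\<Sum>x\<in>insert s S. (cmod (u x))\<^sup>2) > 0"
      using u(2) insert.hyps by (intro sum_pos2[of _ s]) auto
    ultimately have uu: "ip u u \<noteq> 0" by (metis of_real_eq_0_iff less_irrefl)
    define \<alpha> where "\<alpha> = ip (\<lambda>x. t x - k1 x) u / ip u u"
    define k where "k x = k1 x + \<alpha> * u x" for x
    have "k \<in> K"
      using add[OF _ scale[OF u(1)], of k1 \<alpha>] k1(1) unfolding K'_def k_def[abs_def] by blast
    moreover have "ip (\<lambda>x. t x - k x) k' = 0" if k': "k' \<in> K" for k'
    proof -
      \<comment> \<open>Subtracting \<open>\<beta>\<close> times \<open>u\<close> makes
        \<open>k'\<close> vanish at \<open>s\<close>, so the remainder \<open>k''\<close> lies in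
        \<open>K'\<close>.\<close>
      define \<beta> where "\<beta> = k' s / u s"
      define k'' where "k'' x = k' x + (- \<beta>) * u x" for x
      have "k'' \<in> K'"
        using add[OF k' scale[OF u(1), of "- \<beta>"]] u(2)
        unfolding K'_def k''_def[abs_def] \<beta>_def by simp
      have split: "ip (\<lambda>x. t x - k x) k' = ip (\<lambda>x. t x - k1 x) k'' - \<alpha> * ip u k''
          + cnj \<beta> * (ip (\<lambda>x. t x - k1 x) u - \<alpha> * ip u u)"
        unfolding ip_def sum_distrib_left sum.distrib[symmetric] sum_subtractf[symmetric]
        by (rule sum.cong) (simp_all add: k_def k''_def algebra_simps)
      have "ip (\<lambda>x. t x - k1 x) k'' = 0"
        using k1(2)[OF \<open>k'' \<in> K'\<close>] \<open>k'' \<in> K'\<close> by (simp add: ip_def sum_insert K'_def)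
      then show ?thesis
        using uu by (simp add: split ip_u[OF \<open>k'' \<in> K'\<close>] \<alpha>_def)
    qed
    ultimately show ?thesis unfolding ip_def by blast
  qed
qed

lemma sum_cnj_self_eq_zero:
  fixes f :: "'i \<Rightarrow> complex"
  assumes "finite S" "(\<Sum>x\<in>S. f x * cnj (f x)) = 0" "x \<in> S"
  shows "f x = 0"
proof -
  have "of_real (\<Sum>x\<in>S. (cmod (f x))\<^sup>2) = (0 :: complex)"
    using assms(2) by (simp only: complex_norm_square of_real_sum)
  then have "(\<Sum>x\<in>S. (cmod (f x))\<^sup>2) = 0" by (simp only: of_real_eq_0_iff)
  then show ?thesis using assms by (simp add: sum_nonneg_eq_0_iff)
qed

section \<open>Invariant tensors\<close>

lemma sum_PiE_insert:
  assumes "i \<notin> A"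
  shows "(\<Sum>p\<in>insert i A \<rightarrow>\<^sub>E B. f p) = (\<Sum>s\<in>B. \<Sum>p\<in>A \<rightarrow>\<^sub>E B. f (p(i := s)))"
proof -
  have "inj_on (\<lambda>(y, g). g(i := y)) (B \<times> (A \<rightarrow>\<^sub>E B))"
    using inj_combinator[OF assms] .
  then show ?thesis
    unfolding PiE_insert_eq by (simp add: sum.reindex sum.cartesian_product case_prod_unfold)
qed

text \<open>The two sums correspond under changing the value at \<open>i\<close> from
  \<open>s\<close> to \<open>r\<close> and back. This makes replacing \<open>s\<close> by
  \<open>r\<close> in an index adjoint to replacing \<open>r\<close> by \<open>s\<close>, and it
  cancels row terms against column terms in a contraction.\<close>

lemma sum_PiE_update:
  fixes g :: "('i \<Rightarrow> 'b) \<Rightarrow> ('i \<Rightarrow> 'b) \<Rightarrow> 'c::comm_monoid_add"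
  assumes "i \<in> A" "r \<in> B" "s \<in> B" and [simp]: "finite A" "finite B"
  shows "(\<Sum>p\<in>A \<rightarrow>\<^sub>E B. if p i = s then g p (p(i := r)) else 0) =
    (\<Sum>p\<in>A \<rightarrow>\<^sub>E B. if p i = r then g (p(i := s)) p else 0)"
proof -
  have [simp]: "finite (A \<rightarrow>\<^sub>E B)" by (simp add: finite_PiE)
  show ?thesis
    unfolding sum.inter_filter[symmetric, OF \<open>finite (A \<rightarrow>\<^sub>E B)\<close>]
    by (rule sum.reindex_bij_witness[of _ "\<lambda>p. p(i := s)" "\<lambda>p. p(i := r)"])
      (use assms in \<open>auto simp: PiE_iff extensional_def\<close>)
qed

text \<open>With \<open>p\<close> fixed, \<open>b r s\<close> is the image of \<open>c p\<close>
  under a matrix unit acting on the column indices. The squared norms of these images, summed over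
  \<open>s\<close> for a fixed \<open>r\<close>, turn by adjointness into traces over
  \<open>s\<close> that vanish by \<open>b_trace\<close>; so every matrix unit kills
  \<open>c p\<close>.\<close>

lemma traceless_invariant_kernel_zero:
  fixes c :: "('i \<Rightarrow> 'n::finite) \<Rightarrow> ('j \<Rightarrow> 'n) \<Rightarrow> complex"
  assumes J: "finite J" "J \<noteq> {}"
    and dep: "\<And>p q q'. (\<And>j. j \<in> J \<Longrightarrow> q j = q' j) \<Longrightarrow> c p q = c p q'"
    and inv: "\<And>r s p q. (\<Sum>i\<in>I. if p i = r then c (p(i := s)) q else 0) =
      (\<Sum>j\<in>J. if q j = s then c p (q(j := r)) else 0)"
    and traceless: "\<And>i j p q. i \<in> I \<Longrightarrow> j \<in> J \<Longrightarrow> (\<Sum>s\<in>UNIV. c (p(i := s)) (q(j := s))) = 0"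
  shows "c p q = 0"
proof -
  define Q where "Q = (J \<rightarrow>\<^sub>E (UNIV :: 'n set))"
  have fin: "finite Q" using J by (simp add: Q_def finite_PiE)
  define b where "b r s q = (\<Sum>j\<in>J. if q j = s then c p (q(j := r)) else 0)" for r s q
  \<comment> \<open>By \<open>inv\<close>, \<open>b r s\<close> is also given by replacing a row
    index by \<open>s\<close>. Setting the column index \<open>j\<close> to \<open>s\<close> and
    summing over \<open>s\<close> then contracts this row index with \<open>j\<close>.\<close>
  have b_trace: "(\<Sum>s\<in>UNIV. b r s (q(j := s))) = 0" if "j \<in> J" for r j q
  proof -
    have "(\<Sum>s\<in>UNIV. b r s (q(j := s))) =
        (\<Sum>s\<in>UNIV. \<Sum>i\<in>I. if p i = r then c (p(i := s)) (q(j := s)) else 0)"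
      unfolding b_def inv[symmetric] ..
    also have "\<dots> = (\<Sum>i\<in>I. if p i = r then \<Sum>s\<in>UNIV. c (p(i := s)) (q(j := s)) else 0)"
      by (subst sum.swap) (auto intro!: sum.cong)
    also have "\<dots> = 0"
    proof (rule sum.neutral, intro ballI)
      show "(if p i = r then \<Sum>s\<in>UNIV. c (p(i := s)) (q(j := s)) else 0) = 0" if "i \<in> I" for i
        using traceless[OF that \<open>j \<in> J\<close>] by simp
    qed
    finally show ?thesis .
  qed
  have "(\<Sum>s\<in>UNIV. \<Sum>q\<in>Q. b r s q * cnj (b r s q)) = 0" for r
  proof -
    have "(\<Sum>q\<in>Q. b r s q * cnj (b r s q)) =
        (\<Sum>j\<in>J. \<Sum>q\<in>Q. if q j = r then b r s (q(j := s)) * cnj (c p q) else 0)" for s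
    proof -
      have "(\<Sum>q\<in>Q. b r s q * cnj (b r s q)) =
          (\<Sum>q\<in>Q. b r s q * cnj (\<Sum>j\<in>J. if q j = s then c p (q(j := r)) else 0))"
        by (simp only: b_def)
      also have "\<dots> = (\<Sum>q\<in>Q. \<Sum>j\<in>J. if q j = s then b r s q * cnj (c p (q(j := r))) else 0)"
        by (simp add: sum_distrib_left if_distrib cong: if_cong)
      also have "\<dots> = (\<Sum>j\<in>J. \<Sum>q\<in>Q. if q j = s then b r s q * cnj (c p (q(j := r))) else 0)"
        by (rule sum.swap)
      finally show ?thesis
        unfolding Q_def
        using sum_PiE_update[of _ J r UNIV s "\<lambda>q q'. b r s q * cnj (c p q')"] J(1) by simp
    qed
    then have "(\<Sum>s\<in>UNIV. \<Sum>q\<in>Q. b r s q * cnj (b r s q)) =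
        (\<Sum>s\<in>UNIV. \<Sum>j\<in>J. \<Sum>q\<in>Q. if q j = r then b r s (q(j := s)) * cnj (c p q) else 0)"
      by simp
    also have "\<dots> = (\<Sum>j\<in>J. \<Sum>q\<in>Q. \<Sum>s\<in>UNIV.
        if q j = r then b r s (q(j := s)) * cnj (c p q) else 0)"
      by (subst sum.swap, rule sum.cong[OF refl], rule sum.swap)
    also have "\<dots> = (\<Sum>j\<in>J. \<Sum>q\<in>Q. if q j = r then (\<Sum>s\<in>UNIV. b r s (q(j := s))) * cnj (c p q) else 0)"
      by (auto simp: sum_distrib_right intro!: sum.cong)
    also have "\<dots> = 0" by (intro sum.neutral ballI) (simp add: b_trace)
    finally show ?thesis .
  qed
  then have sq: "(\<Sum>(s, q)\<in>UNIV \<times> Q. b r s q * cnj (b r s q)) = 0" for r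
    by (simp add: sum.cartesian_product)
  have b0: "b r s q = 0" if "q \<in> Q" for r s q
    using sum_cnj_self_eq_zero[of "UNIV \<times> Q" "\<lambda>(s, q). b r s q" "(s, q)"] sq[of r] that fin
    by (simp add: case_prod_unfold)
  define q' where "q' = restrict q J"
  have "q' \<in> Q" by (simp add: q'_def Q_def)
  \<comment> \<open>Summing \<open>b r r\<close> over \<open>r\<close> applies the identity matrix,
    which acts by the degree \<open>card J\<close>, a nonzero number.\<close>
  have "of_nat (card J) * c p q' = (\<Sum>j\<in>J. \<Sum>r\<in>UNIV. if q' j = r then c p (q'(j := r)) else 0)"
    by (simp add: if_distrib cong: if_cong)
  also have "\<dots> = (\<Sum>r\<in>UNIV. b r r q')"
    unfolding b_def by (rule sum.swap)
  also have "\<dots> = 0" by (simp add: b0 \<open>q' \<in> Q\<close>)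
  finally have "c p q' = 0" using J by (simp add: card_eq_0_iff)
  then show ?thesis using dep[of q q' p] by (simp add: q'_def)
qed

text \<open>This plays the part of the first fundamental theorem of invariant theory for gl(N).
  Contracting a row index with a column index gives a kernel of the same kind on smaller index sets,
  so by induction all contractions vanish and the traceless case applies. Arbitrary finite
  \<open>I\<close> and \<open>J\<close> allow any pair of indices to be removed.\<close>

lemma invariant_kernel_zero:
  fixes c :: "('i \<Rightarrow> 'n::finite) \<Rightarrow> ('j \<Rightarrow> 'n) \<Rightarrow> complex"
  assumes "finite I" "finite J" "card I = n" "card J = n"
    and "\<And>p p' q. (\<And>i. i \<in> I \<Longrightarrow> p i = p' i) \<Longrightarrow> c p q = c p' q"
    and "\<And>p q q'. (\<And>j. j \<in> J \<Longrightarrow> q j = q' j) \<Longrightarrow> c p q = c p q'"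
    and "\<And>r s p q. (\<Sum>i\<in>I. if p i = r then c (p(i := s)) q else 0) =
      (\<Sum>j\<in>J. if q j = s then c p (q(j := r)) else 0)"
    and "\<And>\<beta>. bij_betw \<beta> J I \<Longrightarrow> (\<Sum>p\<in>I \<rightarrow>\<^sub>E UNIV. c p (p \<circ> \<beta>)) = 0"
  shows "c p q = 0"
  using assms
proof (induction n arbitrary: I J c p q)
  case 0
  have [simp]: "I = {}" "J = {}" using 0(1-4) by auto
  \<comment> \<open>The extensional function space over the empty set has the constant
    \<open>undefined\<close> as its only element, so orthogonality gives the value at one point, and
    over empty index sets \<open>c\<close> is constant.\<close>
  have "c (\<lambda>_. undefined) ((\<lambda>_. undefined) \<circ> undefined) = 0"
    using 0(8)[of undefined] by (simp add: bij_betw_def)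
  then show ?case using 0(5)[of p "\<lambda>_. undefined" q] 0(6)[of q "(\<lambda>_. undefined) \<circ> undefined"]
    by simp
next
  case (Suc n)
  note fin = Suc.prems(1,2) and card = Suc.prems(3,4) and dep = Suc.prems(5,6)
    and inv = Suc.prems(7) and orth = Suc.prems(8)
  have "(\<Sum>s\<in>UNIV. c (p(i := s)) (q(j := s))) = 0" if ij: "i \<in> I" "j \<in> J" for i j p q
  proof (rule Suc.IH[of "I - {i}" "J - {j}" "\<lambda>p q. \<Sum>s\<in>UNIV. c (p(i := s)) (q(j := s))"])
    show "(\<Sum>s\<in>UNIV. c (p(i := s)) (q(j := s))) = (\<Sum>s\<in>UNIV. c (p'(i := s)) (q(j := s)))"
      if "\<And>i'. i' \<in> I - {i} \<Longrightarrow> p i' = p' i'" for p p' q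
      using that by (intro sum.cong refl dep(1)) auto
    show "(\<Sum>s\<in>UNIV. c (p(i := s)) (q(j := s))) = (\<Sum>s\<in>UNIV. c (p(i := s)) (q'(j := s)))"
      if "\<And>j'. j' \<in> J - {j} \<Longrightarrow> q j' = q' j'" for p q q'
      using that by (intro sum.cong refl dep(2)) auto
    show "(\<Sum>k\<in>I - {i}. if p k = r then \<Sum>t\<in>UNIV. c (p(k := s, i := t)) (q(j := t)) else 0) =
      (\<Sum>l\<in>J - {j}. if q l = s then \<Sum>t\<in>UNIV. c (p(i := t)) (q(l := r, j := t)) else 0)"
      (is "?L = ?R") for r s p q
    proof -
      \<comment> \<open>Invariance at \<open>p(i := t)\<close> and \<open>q(j := t)\<close>, with
        the terms of \<open>i\<close> and \<open>j\<close> split off. After summing over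
        \<open>t\<close> both split-off terms equal \<open>c (p(i := s)) (q(j := r))\<close> and
        cancel.\<close>
      have L: "(\<Sum>k\<in>I. if (p(i := t)) k = r then c (p(i := t, k := s)) (q(j := t)) else 0) =
          (if t = r then c (p(i := s)) (q(j := t)) else 0) +
          (\<Sum>k\<in>I - {i}. if p k = r then c (p(k := s, i := t)) (q(j := t)) else 0)" for t
        by (subst sum.remove[OF fin(1) ij(1)], intro arg_cong2[of _ _ _ _ "(+)"] sum.cong refl)
          (simp_all add: fun_upd_twist[where c = i])
      have R: "(\<Sum>l\<in>J. if (q(j := t)) l = s then c (p(i := t)) (q(j := t, l := r)) else 0) =
          (if t = s then c (p(i := t)) (q(j := r)) else 0) +
          (\<Sum>l\<in>J - {j}. if q l = s then c (p(i := t)) (q(l := r, j := t)) else 0)" for t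
        by (subst sum.remove[OF fin(2) ij(2)], intro arg_cong2[of _ _ _ _ "(+)"] sum.cong refl)
          (simp_all add: fun_upd_twist[where c = j])
      have "?L = (\<Sum>t\<in>UNIV. \<Sum>k\<in>I - {i}. if p k = r then c (p(k := s, i := t)) (q(j := t)) else 0)"
        by (subst sum.swap, rule sum.cong[OF refl]) simp
      moreover have "?R = (\<Sum>t\<in>UNIV. \<Sum>l\<in>J - {j}. if q l = s then c (p(i := t)) (q(l := r, j := t)) else 0)"
        by (subst sum.swap, rule sum.cong[OF refl]) simp
      moreover have "(\<Sum>t\<in>UNIV. (if t = r then c (p(i := s)) (q(j := t)) else 0) +
          (\<Sum>k\<in>I - {i}. if p k = r then c (p(k := s, i := t)) (q(j := t)) else 0)) =
        (\<Sum>t\<in>UNIV. (if t = s then c (p(i := t)) (q(j := r)) else 0) +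
          (\<Sum>l\<in>J - {j}. if q l = s then c (p(i := t)) (q(l := r, j := t)) else 0))"
        unfolding L[symmetric] R[symmetric] inv ..
      ultimately show ?thesis by (simp add: sum.distrib)
    qed
    show "(\<Sum>p\<in>I - {i} \<rightarrow>\<^sub>E UNIV. \<Sum>s\<in>UNIV. c (p(i := s)) ((p \<circ> \<beta>)(j := s))) = 0"
      if \<beta>: "bij_betw \<beta> (J - {j}) (I - {i})" for \<beta>
    proof -
      \<comment> \<open>\<open>\<gamma>\<close> extends \<open>\<beta>\<close> by sending
        \<open>j\<close> to \<open>i\<close>; pairing \<open>c\<close> with the permutation tensor
        of \<open>\<gamma>\<close> is pairing its contraction with that of
        \<open>\<beta>\<close>.\<close>
      define \<gamma> where "\<gamma> = \<beta>(j := i)"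
      have "bij_betw \<gamma> (J - {j}) (I - {i})"
        using \<beta> by (subst bij_betw_cong[of _ \<gamma> \<beta>]) (simp_all add: \<gamma>_def)
      then have "bij_betw \<gamma> ((J - {j}) \<union> {j}) ((I - {i}) \<union> {\<gamma> j})"
        by (intro notIn_Un_bij_betw) (simp_all add: \<gamma>_def)
      then have "bij_betw \<gamma> J I" using ij by (simp add: \<gamma>_def insert_absorb)
      then have "0 = (\<Sum>p\<in>insert i (I - {i}) \<rightarrow>\<^sub>E UNIV. c p (p \<circ> \<gamma>))"
        using orth[of \<gamma>] ij by (simp add: insert_absorb o_def)
      also have "\<dots> = (\<Sum>s\<in>UNIV. \<Sum>p\<in>I - {i} \<rightarrow>\<^sub>E UNIV. c (p(i := s)) (p(i := s) \<circ> \<gamma>))"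
        by (rule sum_PiE_insert) simp
      also have "\<dots> = (\<Sum>s\<in>UNIV. \<Sum>p\<in>I - {i} \<rightarrow>\<^sub>E UNIV. c (p(i := s)) ((p \<circ> \<beta>)(j := s)))"
        using bij_betwE[OF \<beta>] by (intro sum.cong refl dep(2)) (auto simp: \<gamma>_def)
      finally show ?thesis by (subst sum.swap) simp
    qed
  qed (use ij fin card in simp_all)
  moreover have "J \<noteq> {}" using card by auto
  ultimately show ?case
    using traceless_invariant_kernel_zero[of J c I] fin(2) dep(2) inv by blast
qed

section \<open>The adjoint action on words\<close>

lemma cscale_minus_left: "(- c) *c x = - (c *c x :: 'a::complex_algebra)"
  using cscale_add_left[of "- c" c x] by (simp add: eq_neg_iff_add_eq_0)

lemma cscale_diff_left: "(c - d) *c x = c *c x - d *c (x :: 'a::complex_algebra)"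
  using cscale_add_left[of c "- d" x] by (simp add: cscale_minus_left)

lemma additive_cscale_left: "Modules.additive (\<lambda>c. c *c (x :: 'a::complex_algebra))"
  by unfold_locales (rule cscale_add_left)

lemma additive_cscale_right: "Modules.additive (\<lambda>x. c *c (x :: 'a::complex_algebra))"
  by unfold_locales (rule cscale_add_right)

lemmas cscale_sum_left = Modules.additive.sum[OF additive_cscale_left]

lemma at_factor_simps:
  "at_factor a (x + y) = at_factor a x + at_factor a y"
  "at_factor a (c *c x) = c *c at_factor a x"
  "at_factor a (x * y) = at_factor a x * at_factor a y"
  "at_factor a 1 = 1"
  using at_factor_hom[of a] unfolding algebra_hom_def by auto

lemma additive_at_factor: "Modules.additive (at_factor a)"
  by unfold_locales (rule at_factor_simps)

lemmas at_factor_zero = Modules.additive.zero[OF additive_at_factor]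
  and at_factor_diff = Modules.additive.diff[OF additive_at_factor]

definition letter_elem :: "'n \<times> 'n \<times> 'l \<Rightarrow> ('l::finite, 'n::finite ugl) tensor_power" where
  "letter_elem = (\<lambda>(p, q, a). at_factor a (ugl_e p q))"

definition monomial :: "('n \<times> 'n \<times> 'l) list \<Rightarrow> ('l::finite, 'n::finite ugl) tensor_power" where
  "monomial w = prod_list (map letter_elem w)"

lemma monomial_simps [simp]:
  "monomial [] = 1" "monomial (x # w) = letter_elem x * monomial w"
  "monomial (v @ w) = monomial v * monomial w"
  by (simp_all add: monomial_def)

text \<open>\<open>gl_act r s\<close> is the action of \<open>e\<^sub>r\<^sub>s\<close> on coefficient functions, but that of \<open>e\<^sub>s\<^sub>r\<close> on functions
  such as \<^term>\<open>monomial\<close> that assign to a word its value.\<close>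

definition gl_act :: "'n \<Rightarrow> 'n \<Rightarrow> (('n \<times> 'n \<times> 'l) list \<Rightarrow> 'b::ab_group_add) \<Rightarrow>
    ('n \<times> 'n \<times> 'l) list \<Rightarrow> 'b" where
  "gl_act r s f w = (\<Sum>i<length w.
     (if fst (w ! i) = r then f (w[i := (s, snd (w ! i))]) else 0) -
     (if fst (snd (w ! i)) = s then f (w[i := (fst (w ! i), r, snd (snd (w ! i)))]) else 0))"

lemma gl_act_Nil [simp]: "gl_act r s f [] = 0"
  by (simp add: gl_act_def)

lemma gl_act_Cons: "gl_act r s f ((p, q, a) # w) =
    (if p = r then f ((s, q, a) # w) else 0) - (if q = s then f ((p, r, a) # w) else 0) +
    gl_act r s (\<lambda>v. f ((p, q, a) # v)) w"
  by (simp add: gl_act_def sum.lessThan_Suc_shift del: sum.lessThan_Suc cong: if_cong)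

lemma additive_gl_act:
  assumes "Modules.additive h"
  shows "gl_act r s (\<lambda>v. h (f v)) w = h (gl_act r s f w)"
  unfolding gl_act_def
  by (simp add: Modules.additive.sum[OF assms] Modules.additive.diff[OF assms] Modules.additive.zero[OF assms] if_distrib[of h]
      cong: if_cong)

lemma diagonal_letter_commutator:
  fixes a :: "'l::finite" and p :: "'n::finite"
  shows "diagonal (ugl_e r s) * letter_elem (p, q, a) - letter_elem (p, q, a) * diagonal (ugl_e r s) =
    (if p = s then letter_elem (r, q, a) else 0) - (if q = r then letter_elem (p, s, a) else 0)"
proof -
  have "diagonal (ugl_e r s) * letter_elem (p, q, a) - letter_elem (p, q, a) * diagonal (ugl_e r s) =
      (\<Sum>b\<in>UNIV. at_factor b (ugl_e r s) * at_factor a (ugl_e p q) -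
        at_factor a (ugl_e p q) * at_factor b (ugl_e r s))"
    by (simp add: letter_elem_def diagonal_ugl_e sum_distrib_left sum_distrib_right sum_subtractf)
  also have "\<dots> = (\<Sum>b\<in>UNIV. if b = a
      then at_factor a (ugl_e r s * ugl_e p q - ugl_e p q * ugl_e r s) else 0)"
    by (rule sum.cong) (auto simp: at_factor_commute at_factor_simps at_factor_diff)
  also have "\<dots> = at_factor a (ugl_e r s * ugl_e p q - ugl_e p q * ugl_e r s)"
    by simp
  finally show ?thesis
    by (auto simp: ugl_e_commutator at_factor_diff at_factor_zero letter_elem_def)
qed

lemma diagonal_monomial_commutator:
  "diagonal (ugl_e r s) * monomial w - monomial w * diagonal (ugl_e r s) = gl_act s r monomial w"
proof (induction w)
  case (Cons x w)
  obtain p q a where [simp]: "x = (p, q, a)" by (cases x)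
  let ?D = "diagonal (ugl_e r s)" and ?e = "letter_elem (p, q, a)"
  have "?D * monomial (x # w) - monomial (x # w) * ?D =
      (?D * ?e - ?e * ?D) * monomial w + ?e * (?D * monomial w - monomial w * ?D)"
    by (simp add: algebra_simps)
  also have "\<dots> = gl_act s r monomial (x # w)"
    unfolding diagonal_letter_commutator Cons gl_act_Cons \<open>x = _\<close> monomial_simps
    by (subst additive_gl_act) (auto simp: Modules.additive_def algebra_simps)
  finally show ?case .
qed simp

lemma finite_words: "finite {w :: 'a::finite list. length w \<le> n}"
  using finite_lists_length_le[of "UNIV :: 'a set" n] by simp

text \<open>Indexing by pairs of a word and a position makes each letter replacement a bijection
  between the terms of the two sides, because it preserves lengths. A general biadditive
  \<open>h\<close> covers both the pairing of coefficients with words and the Hermitian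
  form.\<close>

lemma gl_act_adjoint:
  fixes f :: "('n::finite \<times> 'n \<times> 'l::finite) list \<Rightarrow> 'b::ab_group_add"
    and g :: "('n \<times> 'n \<times> 'l) list \<Rightarrow> 'c::ab_group_add"
    and h :: "'b \<Rightarrow> 'c \<Rightarrow> 'd::ab_group_add"
  assumes left: "\<And>y. Modules.additive (\<lambda>x. h x y)" and right: "\<And>x. Modules.additive (h x)"
  shows "(\<Sum>w | length w \<le> d. h (f w) (gl_act s r g w)) =
    (\<Sum>w | length w \<le> d. h (gl_act r s f w) (g w))"
proof -
  note add = Modules.additive.sum[OF left] Modules.additive.sum[OF right] Modules.additive.diff[OF left]
    Modules.additive.diff[OF right] Modules.additive.zero[OF left] Modules.additive.zero[OF right]
  let ?S = "SIGMA w : {w :: ('n \<times> 'n \<times> 'l) list. length w \<le> d}. {..<length w}"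
  let ?row = "\<lambda>(w :: ('n \<times> 'n \<times> 'l) list, i). \<lambda>s. w[i := (s, snd (w ! i))]"
  let ?col = "\<lambda>(w :: ('n \<times> 'n \<times> 'l) list, i). \<lambda>s. w[i := (fst (w ! i), s, snd (snd (w ! i)))]"
  have fin: "finite ?S" by (intro finite_SigmaI finite_words) simp
  have row: "(\<Sum>(w, i)\<in>?S. if fst (w ! i) = s then h (f w) (g (?row (w, i) r)) else 0) =
      (\<Sum>(w, i)\<in>?S. if fst (w ! i) = r then h (f (?row (w, i) s)) (g w) else 0)"
    unfolding case_prod_unfold sum.inter_filter[symmetric, OF fin]
    by (rule sum.reindex_bij_witness[of _ "\<lambda>x. (?row x s, snd x)" "\<lambda>x. (?row x r, snd x)"]) auto
  have col: "(\<Sum>(w, i)\<in>?S. if fst (snd (w ! i)) = r then h (f w) (g (?col (w, i) s)) else 0) =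
      (\<Sum>(w, i)\<in>?S. if fst (snd (w ! i)) = s then h (f (?col (w, i) r)) (g w) else 0)"
    unfolding case_prod_unfold sum.inter_filter[symmetric, OF fin]
    by (rule sum.reindex_bij_witness[of _ "\<lambda>x. (?col x r, snd x)" "\<lambda>x. (?col x s, snd x)"]) auto
  have "(\<Sum>w | length w \<le> d. h (f w) (gl_act s r g w)) =
      (\<Sum>(w, i)\<in>?S. if fst (w ! i) = s then h (f w) (g (?row (w, i) r)) else 0) -
      (\<Sum>(w, i)\<in>?S. if fst (snd (w ! i)) = r then h (f w) (g (?col (w, i) s)) else 0)"
    by (simp add: gl_act_def add sum.Sigma[symmetric] finite_words if_distrib[of "h _"]
        sum_subtractf cong: if_cong)
  also have "\<dots> = (\<Sum>w | length w \<le> d. h (gl_act r s f w) (g w))"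
    unfolding row col
    by (simp add: gl_act_def add sum.Sigma[symmetric] finite_words if_distrib[of "\<lambda>x. h x _"]
        sum_subtractf cong: if_cong)
  finally show ?thesis .
qed

text \<open>Truncation at length \<open>d\<close> makes the sum finite for an arbitrary
  \<open>c\<close>; since \<open>gl_act\<close> preserves lengths, it is compatible with the
  truncation.\<close>

definition noncomm_eval :: "nat \<Rightarrow> (('n \<times> 'n \<times> 'l) list \<Rightarrow> complex) \<Rightarrow>
    ('l::finite, 'n::finite ugl) tensor_power" where
  "noncomm_eval d c = (\<Sum>w | length w \<le> d. c w *c monomial w)"

lemma noncomm_eval_add: "noncomm_eval d (\<lambda>w. f w + g w) = noncomm_eval d f + noncomm_eval d g"
  by (simp add: noncomm_eval_def cscale_add_left sum.distrib)

lemma noncomm_eval_diff: "noncomm_eval d (\<lambda>w. f w - g w) = noncomm_eval d f - noncomm_eval d g"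
  by (simp add: noncomm_eval_def cscale_diff_left sum_subtractf)

lemma noncomm_eval_scale: "noncomm_eval d (\<lambda>w. c * f w) = c *c noncomm_eval d f"
  by (simp add: noncomm_eval_def cscale_sum_right cscale_cscale)

lemma noncomm_eval_zero: "noncomm_eval d (\<lambda>w. 0) = 0"
  by (simp add: noncomm_eval_def)

lemma noncomm_eval_sum_words:
  assumes "finite A" "\<And>x. x \<in> A \<Longrightarrow> length (u x) \<le> d"
  shows "noncomm_eval d (\<lambda>w. \<Sum>x\<in>A. if w = u x then c x else 0) = (\<Sum>x\<in>A. c x *c monomial (u x))"
proof -
  have "noncomm_eval d (\<lambda>w. \<Sum>x\<in>A. if w = u x then c x else 0) =
      (\<Sum>x\<in>A. \<Sum>w | length w \<le> d. if w = u x then c x *c monomial w else 0)"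
    unfolding noncomm_eval_def
    by (subst sum.swap) (auto simp: cscale_sum_left intro!: sum.cong)
  also have "\<dots> = (\<Sum>x\<in>A. c x *c monomial (u x))"
    using assms(2) by (intro sum.cong) (simp_all add: finite_words)
  finally show ?thesis .
qed

lemma diagonal_eval_commutator:
  "diagonal (ugl_e r s) * noncomm_eval d c - noncomm_eval d c * diagonal (ugl_e r s) =
    noncomm_eval d (gl_act r s c)"
proof -
  have "diagonal (ugl_e r s) * noncomm_eval d c - noncomm_eval d c * diagonal (ugl_e r s) =
      (\<Sum>w | length w \<le> d. c w *c gl_act s r monomial w)"
    unfolding diagonal_monomial_commutator[symmetric]
    by (simp add: noncomm_eval_def sum_distrib_left sum_distrib_right cscale_mult_left
        cscale_mult_right sum_subtractf Modules.additive.diff[OF additive_cscale_right])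
  also have "\<dots> = noncomm_eval d (gl_act r s c)"
    unfolding noncomm_eval_def
    by (rule gl_act_adjoint[OF additive_cscale_left additive_cscale_right])
  finally show ?thesis .
qed

lemma commutes_diagonal_iff:
  fixes x :: "('l::finite, 'n::finite ugl) tensor_power"
  shows "x \<in> centraliser (range diagonal) \<longleftrightarrow>
    (\<forall>r s. diagonal (ugl_e r s) * x - x * diagonal (ugl_e r s) = 0)"
proof
  assume "x \<in> centraliser (range diagonal)"
  then show "\<forall>r s. diagonal (ugl_e r s) * x - x * diagonal (ugl_e r s) = 0"
    by (simp add: centraliser_def)
next
  assume comm: "\<forall>r s. diagonal (ugl_e r s) * x - x * diagonal (ugl_e r s) = 0"
  have hom: "diagonal (u + v) = diagonal u + (diagonal v :: ('l, 'n ugl) tensor_power)"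
    "diagonal (c *c u) = c *c (diagonal u :: ('l, 'n ugl) tensor_power)"
    "diagonal (u * v) = diagonal u * (diagonal v :: ('l, 'n ugl) tensor_power)"
    "diagonal 1 = (1 :: ('l, 'n ugl) tensor_power)"
    for u v :: "'n ugl" and c
    using diagonal_hom unfolding algebra_hom_def by blast+
  have "x * diagonal u = diagonal u * x" for u
  proof (induction u rule: ugl_induct)
    case (e p q)
    then show ?case using comm by simp
  next
    case (mult u v)
    have "x * diagonal (u * v) = diagonal u * x * diagonal v"
      by (simp add: hom mult.IH(1) flip: mult.assoc)
    also have "\<dots> = diagonal (u * v) * x"
      by (simp add: hom mult.IH(2) mult.assoc)
    finally show ?case .
  qed (simp_all add: hom distrib_left distrib_right cscale_mult_left cscale_mult_right)
  then show "x \<in> centraliser (range diagonal)" by (auto simp: centraliser_def)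
qed

section \<open>Contractions of words\<close>

lemma sum_PiE_Un:
  fixes f :: "('a \<Rightarrow> 'b) \<Rightarrow> 'c::comm_monoid_add"
  assumes "A \<inter> B = {}"
  shows "(\<Sum>p\<in>A \<union> B \<rightarrow>\<^sub>E C. f p) =
    (\<Sum>p\<in>A \<rightarrow>\<^sub>E C. \<Sum>q\<in>B \<rightarrow>\<^sub>E C. f (\<lambda>i. if i \<in> B then q i else p i))"
proof -
  define merge where "merge x i = (if i \<in> B then snd x i else fst x i)" for x :: "('a \<Rightarrow> 'b) \<times> ('a \<Rightarrow> 'b)" and i
  define split where "split p = (restrict p A, restrict p B)" for p :: "'a \<Rightarrow> 'b"
  have merge_split: "merge (split p) = p" if "p \<in> A \<union> B \<rightarrow>\<^sub>E C" for p
    using that by (auto simp: merge_def split_def PiE_iff extensional_def fun_eq_iff)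
  have split_merge: "split (merge x) = x" if "x \<in> (A \<rightarrow>\<^sub>E C) \<times> (B \<rightarrow>\<^sub>E C)" for x
    using that assms by (cases x) (auto simp: merge_def split_def PiE_iff extensional_def fun_eq_iff)
  have "(\<Sum>p\<in>A \<union> B \<rightarrow>\<^sub>E C. f p) = (\<Sum>x\<in>(A \<rightarrow>\<^sub>E C) \<times> (B \<rightarrow>\<^sub>E C). f (merge x))"
  proof (rule sum.reindex_bij_witness[of _ merge split])
    show "split p \<in> (A \<rightarrow>\<^sub>E C) \<times> (B \<rightarrow>\<^sub>E C)" if "p \<in> A \<union> B \<rightarrow>\<^sub>E C" for p
      using that by (auto simp: split_def)
    show "merge x \<in> A \<union> B \<rightarrow>\<^sub>E C" if "x \<in> (A \<rightarrow>\<^sub>E C) \<times> (B \<rightarrow>\<^sub>E C)" for x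
      using that by (cases x) (auto simp: merge_def PiE_iff extensional_def)
  qed (simp_all only: merge_split split_merge)
  then show ?thesis
    by (simp add: sum.cartesian_product case_prod_unfold merge_def[abs_def])
qed

lemma bij_betw_map_PiE_lists:
  fixes xs :: "'a list"
  assumes "distinct xs"
  shows "bij_betw (\<lambda>v :: 'a \<Rightarrow> 'b. map v xs) (set xs \<rightarrow>\<^sub>E UNIV) {l. length l = length xs}"
proof (rule bij_betw_imageI)
  show "inj_on (\<lambda>v. map v xs) (set xs \<rightarrow>\<^sub>E UNIV)"
    by (rule inj_onI) (auto simp: PiE_iff intro: extensionalityI)
  have "l \<in> (\<lambda>v. map v xs) ` (set xs \<rightarrow>\<^sub>E UNIV)" if "length l = length xs" for l :: "'b list"
  proof (rule image_eqI)
    show "l = map (restrict (\<lambda>x. the (map_of (zip xs l) x)) (set xs)) xs"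
      using that assms by (auto intro!: nth_equalityI simp: map_of_zip_nth)
  qed simp
  then show "(\<lambda>v. map v xs) ` (set xs \<rightarrow>\<^sub>E UNIV) = {l :: 'b list. length l = length xs}"
    by auto
qed

section \<open>Words in summation variables and their contractions\<close>

definition col :: "'v \<times> 'v \<times> 'l \<Rightarrow> 'v" where
  "col x = fst (snd x)"

text \<open>Row and column variables get separate assignments because \<open>gl_act\<close> changes
  one index of a letter at a time; contractions use the same assignment for both.\<close>

definition instantiate :: "('v \<Rightarrow> 'n) \<Rightarrow> ('v \<Rightarrow> 'n) \<Rightarrow> ('v \<times> 'v \<times> 'l) list \<Rightarrow> ('n \<times> 'n \<times> 'l) list" where
  "instantiate u v = map (\<lambda>(x, y, a). (u x, v y, a))"

lemma instantiate_simps [simp]: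
  "instantiate u v [] = []" "instantiate u v ((x, y, a) # w) = (u x, v y, a) # instantiate u v w"
  "instantiate u v (w @ w') = instantiate u v w @ instantiate u v w'"
  "length (instantiate u v w) = length w"
  by (simp_all add: instantiate_def)

lemma instantiate_cong:
  assumes "\<And>x. x \<in> fst ` set w \<Longrightarrow> u x = u' x" "\<And>y. y \<in> col ` set w \<Longrightarrow> v y = v' y"
  shows "instantiate u v w = instantiate u' v' w"
  unfolding instantiate_def
proof (rule map_cong[OF refl])
  fix l assume "l \<in> set w"
  then have "u (fst l) = u' (fst l)" "v (col l) = v' (col l)" using assms by blast+
  then show "(case l of (x, y, a) \<Rightarrow> (u x, v y, a)) = (case l of (x, y, a) \<Rightarrow> (u' x, v' y, a))"
    by (simp add: case_prod_unfold col_def)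
qed

text \<open>Here the indices in a letter \<open>(x, y, a)\<close> are summation variables. Variables in \<open>V\<close> that do not
  occur in the word only contribute a factor N each.\<close>

definition contraction :: "'v set \<Rightarrow> ('v \<times> 'v \<times> 'l) list \<Rightarrow> ('l::finite, 'n::finite ugl) tensor_power" where
  "contraction V w = (\<Sum>v\<in>V \<rightarrow>\<^sub>E UNIV. monomial (instantiate v v w))"

text \<open>Each variable that occurs does so once as a row and once as a column. The multiset
  equation states this without naming the permutation, so it survives reordering and the removal of
  a cycle.\<close>

definition balanced :: "'v set \<Rightarrow> ('v \<times> 'v \<times> 'l) list \<Rightarrow> bool" where
  "balanced V w \<longleftrightarrow> finite V \<and> distinct (map fst w) \<and> mset (map fst w) = mset (map col w) \<and>
    set (map fst w) \<subseteq> V"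

lemma balancedD:
  assumes "balanced V w"
  shows "finite V" "distinct (map fst w)" "distinct (map col w)"
    "fst ` set w = col ` set w" "fst ` set w \<subseteq> V" "col ` set w \<subseteq> V"
proof -
  show "finite V" "distinct (map fst w)" "fst ` set w \<subseteq> V"
    using assms by (auto simp: balanced_def)
  show "distinct (map col w)"
    using assms mset_eq_imp_distinct_iff[of "map fst w" "map col w"] by (simp add: balanced_def)
  show *: "fst ` set w = col ` set w"
    using assms mset_eq_setD[of "map fst w" "map col w"] by (simp add: balanced_def)
  show "col ` set w \<subseteq> V"
    using * \<open>fst ` set w \<subseteq> V\<close> by simp
qed

lemma balanced_perm:
  assumes "balanced V w" "mset w = mset w'"
  shows "balanced V w'"
proof -
  have *: "mset (map f w) = mset (map f w')" for f :: "_ \<Rightarrow> 'a"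
    using assms(2) by simp
  have "set (map fst w) = set (map fst w')" "distinct (map fst w) = distinct (map fst w')"
    using *[of fst] by (rule mset_eq_setD, rule mset_eq_imp_distinct_iff)
  then show ?thesis
    using assms(1) *[of fst] *[of col] unfolding balanced_def by simp
qed

text \<open>Each variable names the row of at most one letter and the column of at most one letter,
  so changing an index of a letter amounts to changing one value of \<open>u\<close> or
  \<open>v\<close>.\<close>

lemma gl_act_instantiate:
  assumes "distinct (map fst w)" "distinct (map col w)"
  shows "gl_act s r f (instantiate u v w) =
    (\<Sum>z\<in>fst ` set w. if u z = s then f (instantiate (u(z := r)) v w) else 0) -
    (\<Sum>z\<in>col ` set w. if v z = r then f (instantiate u (v(z := s)) w) else 0)"
  using assms
proof (induction w arbitrary: f)
  case (Cons l w)
  obtain x y a where l: "l = (x, y, a)" by (cases l)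
  have notin: "x \<notin> fst ` set w" "y \<notin> col ` set w" using Cons.prems by (auto simp: l col_def)
  have [simp]: "instantiate (u(x := r)) v w = instantiate u v w"
    "instantiate u (v(y := s)) w = instantiate u v w"
    by (rule instantiate_cong; use notin in force)+
  have ne: "x \<noteq> z" if "z \<in> fst ` set w" for z using that notin by blast
  have ne': "y \<noteq> z" if "z \<in> col ` set w" for z using that notin by blast
  note ne = ne ne'
  let ?I = "instantiate u v w"
  have "(\<Sum>z\<in>fst ` set (l # w). if u z = s then f (instantiate (u(z := r)) v (l # w)) else 0) =
      (if u x = s then f ((r, v y, a) # ?I) else 0) +
      (\<Sum>z\<in>fst ` set w. if u z = s then f ((u x, v y, a) # instantiate (u(z := r)) v w) else 0)"
    by (simp add: l notin, intro sum.cong refl) (simp add: l ne)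
  moreover have "(\<Sum>z\<in>col ` set (l # w). if v z = r then f (instantiate u (v(z := s)) (l # w)) else 0) =
      (if v y = r then f ((u x, s, a) # ?I) else 0) +
      (\<Sum>z\<in>col ` set w. if v z = r then f ((u x, v y, a) # instantiate u (v(z := s)) w) else 0)"
  proof -
    have "col ` set (l # w) = insert y (col ` set w)" by (simp add: l col_def)
    then show ?thesis by (simp add: l notin, intro sum.cong refl) (simp add: l ne)
  qed
  moreover have "gl_act s r f (instantiate u v (l # w)) =
      (if u x = s then f ((r, v y, a) # ?I) else 0) - (if v y = r then f ((u x, s, a) # ?I) else 0) +
      gl_act s r (\<lambda>v'. f ((u x, v y, a) # v')) ?I"
    by (simp add: l gl_act_Cons)
  moreover have "distinct (map fst w)" "distinct (map col w)" using Cons.prems by auto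
  ultimately show ?case
    by (simp only: Cons.IH add_diff_add)
qed simp

text \<open>For each variable \<open>z\<close>, the terms changing \<open>z\<close> as a row index
  and those changing it as a column index have the same sum over all assignments, by a change of the
  value at \<open>z\<close>.\<close>

lemma contraction_commutes:
  fixes w :: "('v \<times> 'v \<times> 'l::finite) list"
  assumes "balanced V w"
  shows "(contraction V w :: ('l, 'n::finite ugl) tensor_power) \<in> centraliser (range diagonal)"
  unfolding commutes_diagonal_iff
proof (intro allI)
  fix r s :: 'n
  note bal = balancedD[OF assms]
  let ?D = "diagonal (ugl_e r s) :: ('l, 'n ugl) tensor_power"
  let ?m = "\<lambda>u v. monomial (instantiate u v w) :: ('l, 'n ugl) tensor_power"
  have "?D * contraction V w - contraction V w * ?D =
      (\<Sum>v\<in>V \<rightarrow>\<^sub>E UNIV. gl_act s r monomial (instantiate v v w))"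
    by (simp add: contraction_def sum_distrib_left sum_distrib_right sum_subtractf
        flip: diagonal_monomial_commutator)
  also have "\<dots> =
      (\<Sum>z\<in>fst ` set w. \<Sum>v\<in>V \<rightarrow>\<^sub>E UNIV. if v z = s then ?m (v(z := r)) v else 0) -
      (\<Sum>z\<in>fst ` set w. \<Sum>v\<in>V \<rightarrow>\<^sub>E UNIV. if v z = r then ?m v (v(z := s)) else 0)"
    unfolding gl_act_instantiate[OF bal(2,3)] bal(4)[symmetric] sum_subtractf
    by (intro arg_cong2[of _ _ _ _ "(-)"] sum.swap)
  also have "\<dots> = 0"
    unfolding right_minus_eq
    by (rule sum.cong[OF refl], rule sum_PiE_update[of _ V r UNIV s "\<lambda>v v'. ?m v' v"])
      (use bal in auto)
  finally show "?D * contraction V w - contraction V w * ?D = 0" .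
qed

text \<open>The equation with \<open>rotate1\<close> says that the row variable of each letter is
  the column variable of the next, cyclically, which is the index pattern of a polarised
  trace.\<close>

lemma contraction_cycle:
  fixes w :: "('v \<times> 'v \<times> 'l::finite) list"
  assumes "distinct (map col w)" "map fst w = rotate1 (map col w)"
  shows "(contraction (col ` set w) w :: ('l, 'n::finite ugl) tensor_power) = polarised_trace (map (snd \<circ> snd) w)"
proof -
  let ?d = "length w"
  define g :: "'n list \<Rightarrow> ('l, 'n ugl) tensor_power" where "g js = prod_list (map (\<lambda>k. at_factor (snd (snd (w ! k)))
    (ugl_e (js ! (Suc k mod ?d)) (js ! k))) [0..<?d])" for js
  have mon: "monomial (instantiate v v w) = g (map v (map col w))" for v
  proof -
    have "fst (w ! k) = col (w ! (Suc k mod ?d))" if "k < ?d" for k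
    proof -
      have "fst (w ! k) = map fst w ! k" using that by simp
      also have "\<dots> = map col w ! (Suc k mod ?d)"
        unfolding assms(2) using that by (subst nth_rotate1) simp_all
      also have "\<dots> = col (w ! (Suc k mod ?d))" using that by (intro nth_map mod_less_divisor) auto
      finally show ?thesis .
    qed
    moreover have "map (v \<circ> col) w ! (Suc k mod ?d) = v (col (w ! (Suc k mod ?d)))" if "k < ?d" for k
      using that by (subst nth_map) (auto intro: mod_less_divisor)
    ultimately show ?thesis
      unfolding monomial_def g_def instantiate_def letter_elem_def
      by (intro arg_cong[of _ _ prod_list] nth_equalityI)
        (auto simp: case_prod_unfold col_def)
  qed
  have "(contraction (col ` set w) w :: ('l, 'n ugl) tensor_power) = (\<Sum>v\<in>set (map col w) \<rightarrow>\<^sub>E UNIV. g (map v (map col w)))"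
    by (simp add: contraction_def mon)
  also have "\<dots> = (\<Sum>js | length js = ?d. g js)"
    using sum.reindex_bij_betw[OF bij_betw_map_PiE_lists[OF assms(1)], of g] by simp
  also have "\<dots> = polarised_trace (map (snd \<circ> snd) w)"
    unfolding polarised_trace_def g_def length_map
    by (intro sum.cong refl arg_cong[of _ _ prod_list] map_cong) auto
  finally show ?thesis .
qed

section \<open>Reordering the letters of a contraction\<close>

lemma subalgebra_generated_zero: "0 \<in> subalgebra_generated S"
  using subalgebra_generated.scale[OF subalgebra_generated.one, of 0] by simp

lemma subalgebra_generated_diff:
  "x \<in> subalgebra_generated S \<Longrightarrow> y \<in> subalgebra_generated S \<Longrightarrow> x - y \<in> subalgebra_generated S"
  using subalgebra_generated.add[of x S "(- 1) *c y"] subalgebra_generated.scale[of y S "- 1"]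
  by (simp add: cscale_minus_one)

lemma subalgebra_generated_sum:
  "(\<And>i. i \<in> I \<Longrightarrow> f i \<in> subalgebra_generated S) \<Longrightarrow> (\<Sum>i\<in>I. f i) \<in> subalgebra_generated S"
  by (induction I rule: infinite_finite_induct)
    (auto intro: subalgebra_generated.add subalgebra_generated_zero)

text \<open>If \<open>x \<noteq> y\<close>, the condition \<open>v y = v x\<close> eliminates the variable \<open>y\<close>, which then occurs only as a row
  index, in favour of \<open>x\<close>.\<close>

lemma contraction_collapse:
  fixes w :: "('v \<times> 'v \<times> 'l::finite) list"
  assumes "finite V" "distinct (x # map fst w)" "set (x # map fst w) \<subseteq> V"
    and eq: "mset (x # map fst w) = mset (y # map col w)"
  obtains V' and w' :: "('v \<times> 'v \<times> 'l) list" where "balanced V' w'" "length w' = length w"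
    "(\<Sum>v\<in>V \<rightarrow>\<^sub>E UNIV. if v y = v x then monomial (instantiate v v w) else 0) =
      (contraction V' w' :: ('l, 'n::finite ugl) tensor_power)"
proof (cases "x = y")
  case True
  then have "balanced V w" using assms by (simp add: balanced_def)
  from that[OF this] True show ?thesis by (simp add: contraction_def)
next
  case False
  have dist: "distinct (y # map col w)" using assms(2) eq mset_eq_imp_distinct_iff by blast
  have y: "y \<in> fst ` set w" using mset_eq_setD[OF eq] False by auto
  then have "y \<in> V" using assms(3) by auto
  define f where "f z = (if z = y then x else z)" for z
  define w' where "w' = map (\<lambda>(a, b). (f a, b)) w"
  have rows: "map fst w' = map f (map fst w)" and cols: "map col w' = map col w"
    by (simp_all add: w'_def col_def case_prod_unfold)
  have "mset (map f (map fst w)) = mset (map col w)"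
  proof -
    obtain as bs where ab: "map fst w = as @ y # bs" using y split_list[of y "map fst w"] by auto
    have "map f as = as" "map f bs = bs"
      using assms(2) unfolding ab by (auto simp: f_def intro!: map_idI)
    then have "add_mset y (mset (map f (map fst w))) = mset (x # map fst w)"
      by (simp add: ab f_def)
    then show ?thesis using eq by simp
  qed
  then have "mset (map fst w') = mset (map col w')" by (simp only: rows cols)
  moreover have "distinct (map col w')" using dist by (simp only: cols) simp
  ultimately have "balanced (V - {y}) w'"
    using assms(1,3) mset_eq_imp_distinct_iff[of "map fst w'" "map col w'"] False
    by (auto simp: balanced_def rows f_def simp del: mset_map)
  moreover have "(\<Sum>v\<in>V \<rightarrow>\<^sub>E UNIV. if v y = v x then monomial (instantiate v v w) else 0) =
      (contraction (V - {y}) w' :: ('l, 'n ugl) tensor_power)"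
  proof -
    have inst: "instantiate (v(y := v x)) (v(y := v x)) w = instantiate v v w'" for v :: "'v \<Rightarrow> 'n"
    proof -
      have "fst (snd l) \<noteq> y" if "l \<in> set w" for l
        using dist that by (auto simp: col_def)
      then show ?thesis
        unfolding instantiate_def w'_def map_map
        by (intro map_cong refl) (simp add: f_def case_prod_unfold)
    qed
    have "(\<Sum>v\<in>insert y (V - {y}) \<rightarrow>\<^sub>E UNIV. if v y = v x then monomial (instantiate v v w) else 0) =
        (\<Sum>s\<in>UNIV. \<Sum>v\<in>V - {y} \<rightarrow>\<^sub>E UNIV. if s = v x
          then monomial (instantiate (v(y := s)) (v(y := s)) w) :: ('l, 'n ugl) tensor_power else 0)"
      by (subst sum_PiE_insert) (use False in auto)
    also have "\<dots> = (\<Sum>v\<in>V - {y} \<rightarrow>\<^sub>E UNIV. monomial (instantiate v v w'))"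
      by (subst sum.swap) (simp add: inst)
    finally show ?thesis using \<open>y \<in> V\<close> by (simp add: contraction_def insert_absorb)
  qed
  ultimately show ?thesis using that by (simp add: w'_def)
qed

lemma letter_commutator:
  "letter_elem (p, q, a) * letter_elem (r, s, b) - letter_elem (r, s, b) * letter_elem (p, q, a) =
    (if a = b then (if q = r then letter_elem (p, s, a) else 0) -
      (if s = p then letter_elem (r, q, a) else 0) else 0)"
proof (cases "a = b")
  case True
  have "letter_elem (p, q, a) * letter_elem (r, s, a) - letter_elem (r, s, a) * letter_elem (p, q, a) =
      at_factor a (ugl_e p q * ugl_e r s - ugl_e r s * ugl_e p q)"
    by (simp add: letter_elem_def at_factor_simps at_factor_diff)
  then show ?thesis
    using True by (auto simp: ugl_e_commutator at_factor_diff at_factor_zero letter_elem_def)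
qed (simp add: letter_elem_def at_factor_commute)

text \<open>The Kronecker deltas of the commutator become conditions identifying two variables. They
  leave words with one letter less, to which \<open>contraction_collapse\<close> is applied.\<close>

lemma contraction_swap:
  fixes us vs :: "('v \<times> 'v \<times> 'l::finite) list"
  shows "contraction V (us @ (x, y, a) # (x', y', b) # vs) -
      contraction V (us @ (x', y', b) # (x, y, a) # vs) =
    (if a = b then
      (\<Sum>v\<in>V \<rightarrow>\<^sub>E UNIV. if v y = v x' then monomial (instantiate v v (us @ (x, y', a) # vs)) else 0) -
      (\<Sum>v\<in>V \<rightarrow>\<^sub>E UNIV. if v y' = v x then monomial (instantiate v v (us @ (x', y, a) # vs)) else 0)
     else (0 :: ('l, 'n::finite ugl) tensor_power))"
proof -
  have "monomial (instantiate v v (us @ (x, y, a) # (x', y', b) # vs)) -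
      monomial (instantiate v v (us @ (x', y', b) # (x, y, a) # vs)) =
    (if a = b then
      (if v y = v x' then monomial (instantiate v v (us @ (x, y', a) # vs)) else 0) -
      (if v y' = v x then monomial (instantiate v v (us @ (x', y, a) # vs)) else 0)
     else (0 :: ('l, 'n ugl) tensor_power))" for v
  proof -
    have "monomial (instantiate v v (us @ (x, y, a) # (x', y', b) # vs)) -
        monomial (instantiate v v (us @ (x', y', b) # (x, y, a) # vs)) =
      monomial (instantiate v v us) *
        (letter_elem (v x, v y, a) * letter_elem (v x', v y', b) -
         letter_elem (v x', v y', b) * letter_elem (v x, v y, a) :: ('l, 'n ugl) tensor_power) *
        monomial (instantiate v v vs)"
      by (simp add: algebra_simps)
    then show ?thesis
      unfolding letter_commutator by (auto simp: algebra_simps)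
  qed
  then show ?thesis
    by (simp add: contraction_def flip: sum_subtractf)
qed

text \<open>Exchanging adjacent letters changes a contraction by contractions with one letter less,
  which lie in the subalgebra by \<open>IH\<close>. There the variable set is arbitrary because a
  collapse can remove a variable.\<close>

lemma contraction_perm:
  fixes w :: "('v \<times> 'v \<times> 'l::finite) list"
  assumes IH: "\<And>V w'. balanced V w' \<Longrightarrow> Suc (length w') = length w \<Longrightarrow>
      (contraction V (w' :: ('v \<times> 'v \<times> 'l) list) :: ('l, 'n::finite ugl) tensor_power) \<in> subalgebra_generated S"
    and bal: "balanced V w" and perm: "mset w = mset w'"
  shows "(contraction V w - contraction V w' :: ('l, 'n ugl) tensor_power) \<in> subalgebra_generated S"
proof -
  define rel where "rel u v \<longleftrightarrow>
    (contraction V u - contraction V v :: ('l, 'n ugl) tensor_power) \<in> subalgebra_generated S" for u v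
  have refl: "rel u u" for u by (simp add: rel_def subalgebra_generated_zero)
  have trans: "rel u w" if "rel u v" "rel v w" for u v w
    using subalgebra_generated.add[OF that[unfolded rel_def]] by (simp add: rel_def)
  have collapse: "(\<Sum>v\<in>V \<rightarrow>\<^sub>E UNIV. if v y = v x then monomial (instantiate v v u) else 0)
      \<in> (subalgebra_generated S :: ('l, 'n ugl) tensor_power set)"
    if "distinct (x # map fst u)" "set (x # map fst u) \<subseteq> V"
      "mset (x # map fst u) = mset (y # map col u)" "Suc (length u) = length w" for x y u
  proof -
    note u = that
    obtain V' and w' :: "('v \<times> 'v \<times> 'l) list" where *: "balanced V' w'" "length w' = length u"
      "(\<Sum>v\<in>V \<rightarrow>\<^sub>E UNIV. if v y = v x then monomial (instantiate v v u) else 0) =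
        (contraction V' w' :: ('l, 'n ugl) tensor_power)"
      by (rule contraction_collapse[OF balancedD(1)[OF bal] u(1-3)])
    show ?thesis unfolding *(3) by (rule IH) (use * u in auto)
  qed
  have swap: "rel (us @ l # l' # vs) (us @ l' # l # vs)"
    if "balanced V (us @ l # l' # vs)" "length (us @ l # l' # vs) = length w" for us vs l l'
  proof -
    obtain x y a x' y' b where l: "l = (x, y, a)" "l' = (x', y', b)" by (cases l, cases l')
    note bal = that(1)[unfolded balanced_def l]
    have "(\<Sum>v\<in>V \<rightarrow>\<^sub>E UNIV. if v y = v x' then monomial (instantiate v v (us @ (x, y', a) # vs)) else 0)
        \<in> (subalgebra_generated S :: ('l, 'n ugl) tensor_power set)"
      by (rule collapse) (use bal that(2) in \<open>auto simp: col_def add_mset_commute\<close>)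
    moreover have "(\<Sum>v\<in>V \<rightarrow>\<^sub>E UNIV. if v y' = v x then monomial (instantiate v v (us @ (x', y, a) # vs)) else 0)
        \<in> (subalgebra_generated S :: ('l, 'n ugl) tensor_power set)"
      by (rule collapse) (use bal that(2) in \<open>auto simp: col_def add_mset_commute\<close>)
    ultimately show ?thesis
      unfolding rel_def l contraction_swap
      by (auto intro: subalgebra_generated_diff subalgebra_generated_zero)
  qed
  have move: "rel (us @ vs @ l # ws) (us @ l # vs @ ws)"
    if "balanced V (us @ vs @ l # ws)" "length (us @ vs @ l # ws) = length w" for us vs ws l
    using that
  proof (induction vs arbitrary: ws rule: rev_induct)
    case (snoc k vs)
    have "rel (us @ vs @ k # l # ws) (us @ vs @ l # k # ws)"
      using swap[of "us @ vs" k l ws] snoc.prems by simp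
    moreover have "balanced V (us @ vs @ l # k # ws)"
      by (rule balanced_perm[OF snoc.prems(1)]) simp
    then have "rel (us @ vs @ l # k # ws) (us @ l # vs @ k # ws)"
      using snoc.IH[of "k # ws"] snoc.prems(2) by simp
    ultimately show ?case using trans by simp
  qed (simp add: refl)
  \<comment> \<open>The prefix \<open>us\<close> is already in its final order; the first letter of
    \<open>v'\<close> is moved directly behind it, and the rest follows by induction.\<close>
  have "rel (us @ v) (us @ v')"
    if "balanced V (us @ v)" "length (us @ v) = length w" "mset v = mset v'" for us v v'
    using that
  proof (induction v' arbitrary: us v)
    case (Cons l v')
    then obtain as bs where v: "v = as @ l # bs"
      by (metis list.set_intros(1) mset_eq_setD split_list)
    have "rel (us @ v) (us @ l # as @ bs)"
      unfolding v by (rule move) (use Cons.prems v in auto)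
    moreover have "balanced V (us @ l # as @ bs)"
      by (rule balanced_perm[OF Cons.prems(1)]) (simp add: v)
    then have "rel ((us @ [l]) @ as @ bs) ((us @ [l]) @ v')"
      by (intro Cons.IH) (use Cons.prems v in auto)
    ultimately show ?case using trans by simp
  qed (simp add: refl)
  from this[of "[]" w w'] show ?thesis using bal perm by (simp add: rel_def)
qed

text \<open>Take a longest path of distinct letters in which each row variable is the next column
  variable. The letter continuing the path already lies on it, and distinctness of the rows forces
  it to be the first letter, so the path closes up.\<close>

lemma exists_cycle:
  assumes bal: "balanced V w" and "w \<noteq> []"
  obtains us rest where "us \<noteq> []" "mset w = mset (us @ rest)" "map fst us = rotate1 (map col us)"
proof -
  define path where "path us \<longleftrightarrow> us \<noteq> [] \<and> distinct us \<and> set us \<subseteq> set w \<and>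
    butlast (map fst us) = tl (map col us)" for us
  have dw: "distinct w" using balancedD(2)[OF bal] by (simp add: distinct_map)
  have "path [hd w]" using \<open>w \<noteq> []\<close> by (simp add: path_def)
  moreover have bound: "length us < Suc (length w)" if "path us" for us
    using that dw unfolding path_def
    by (metis card_mono distinct_card finite_set less_Suc_eq_le)
  ultimately obtain us where us: "path us" "\<And>vs. path vs \<Longrightarrow> length vs \<le> length us"
    using ex_has_greatest_nat[of path "[hd w]" length "Suc (length w)"] by (metis less_imp_le)
  have ne: "us \<noteq> []" using us(1) by (simp add: path_def)
  have "last us \<in> set w" using us(1) last_in_set[OF ne] by (auto simp: path_def)
  then have "fst (last us) \<in> fst ` set w" by (rule imageI)
  then obtain l where l: "l \<in> set w" "col l = fst (last us)"
    using balancedD(4)[OF bal] by auto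
  have "l \<in> set us"
  proof (rule ccontr)
    assume "l \<notin> set us"
    have "butlast (map fst (us @ [l])) = map fst us" by simp
    also have "\<dots> = butlast (map fst us) @ [fst (last us)]"
      using ne by (metis append_butlast_last_id last_map map_is_Nil_conv)
    also have "\<dots> = tl (map col us) @ [col l]" using us(1) l(2) by (simp add: path_def)
    also have "\<dots> = tl (map col (us @ [l]))" using ne by (cases us) auto
    finally have "butlast (map fst (us @ [l])) = tl (map col (us @ [l]))" .
    moreover have "us @ [l] \<noteq> []" "distinct (us @ [l])" "set (us @ [l]) \<subseteq> set w"
      using us(1) l(1) \<open>l \<notin> set us\<close> by (auto simp: path_def)
    ultimately have "path (us @ [l])" unfolding path_def by blast
    then show False using us(2) by fastforce
  qed
  have inj: "inj_on fst (set w)" "inj_on col (set w)"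
    using balancedD(2,3)[OF bal] by (simp_all add: distinct_map)
  \<comment> \<open>Otherwise \<open>col l\<close> would be the row variable of an earlier letter of
    the path as well as of its last letter.\<close>
  have "l = hd us"
  proof (rule ccontr)
    assume "l \<noteq> hd us"
    then have "l \<in> set (tl us)" using \<open>l \<in> set us\<close> ne by (cases us) auto
    then have "col l \<in> set (butlast (map fst us))"
      using us(1) by (simp add: path_def flip: map_tl)
    then have "fst (last us) \<in> fst ` set (butlast us)" using l(2) by (simp flip: map_butlast)
    then obtain k where "k \<in> set (butlast us)" "fst k = fst (last us)" by auto
    then have "last us \<in> set (butlast us)"
      using inj(1) us(1) unfolding path_def inj_on_def by (metis in_mono in_set_butlastD last_in_set)
    moreover have "distinct (butlast us @ [last us])" using us(1) ne by (simp add: path_def)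
    ultimately show False by simp
  qed
  have "map fst us = butlast (map fst us) @ [fst (last us)]"
    using ne by (metis append_butlast_last_id last_map map_is_Nil_conv)
  also have "\<dots> = tl (map col us) @ [col (hd us)]"
    using us(1) l(2) \<open>l = hd us\<close> by (simp add: path_def)
  also have "\<dots> = rotate1 (map col us)" using ne by (cases us) auto
  finally have rot: "map fst us = rotate1 (map col us)" .
  have "mset us \<subseteq># mset w"
    using us(1) dw subset_imp_msubset_mset_set[of "set us" "set w"]
    by (simp add: path_def mset_set_set)
  then have "mset w = mset us + (mset w - mset us)" by simp
  moreover obtain rest where "mset rest = mset w - mset us" using ex_mset by blast
  ultimately have "mset w = mset (us @ rest)" by simp
  then show ?thesis using that ne rot by blast
qed

section \<open>Contractions lie in the algebra of polarised traces\<close>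

lemma mset_rotate1: "mset (rotate1 xs) = mset xs"
  by (cases xs) auto

lemma contraction_append:
  assumes "fst ` set us \<union> col ` set us \<subseteq> A" "fst ` set vs \<union> col ` set vs \<subseteq> B" "A \<inter> B = {}"
  shows "contraction (A \<union> B) (us @ vs) = contraction A us * contraction B vs"
proof -
  have "instantiate (\<lambda>i. if i \<in> B then q i else p i) (\<lambda>i. if i \<in> B then q i else p i) us = instantiate p p us"
    "instantiate (\<lambda>i. if i \<in> B then q i else p i) (\<lambda>i. if i \<in> B then q i else p i) vs = instantiate q q vs"
    for p q :: "'a \<Rightarrow> 'c"
    by (rule instantiate_cong; use assms in auto)+
  then show ?thesis
    by (simp add: contraction_def sum_PiE_Un[OF assms(3)] sum_product)
qed

text \<open>By \<open>contraction_perm\<close> a cycle can be moved to the front; the contraction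
  then factors into a polarised trace and a contraction of the remaining letters. Both the second
  factor and the error of reordering are covered by induction on the length.\<close>

lemma contraction_in_polarised_trace_algebra:
  fixes w :: "('v \<times> 'v \<times> 'l::finite) list"
  assumes "balanced V w"
  shows "(contraction V w :: ('l, 'n::finite ugl) tensor_power) \<in> polarised_trace_algebra"
  using assms
proof (induction "length w" arbitrary: V w rule: less_induct)
  case less
  show ?case
  proof (cases "w = []")
    case True
    then show ?thesis
      by (simp add: contraction_def polarised_trace_algebra_def subalgebra_generated.one subalgebra_generated_sum)
  next
    case False
    obtain us rest where *: "us \<noteq> []" "mset w = mset (us @ rest)" "map fst us = rotate1 (map col us)"
      using exists_cycle[OF less.prems False] .
    have bal: "balanced V (us @ rest)" using balanced_perm[OF less.prems *(2)] .
    define A where "A = col ` set us"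
    have A: "fst ` set us = A" unfolding A_def by (metis *(3) list.set_map set_rotate1)
    have "mset (map fst us) = mset (map col us)" unfolding *(3) by (rule mset_rotate1)
    then have "mset (map fst rest) = mset (map col rest)"
      using bal unfolding balanced_def by simp
    moreover have "finite V" "distinct (map fst rest)" "set (map fst rest) \<subseteq> V - A"
      using balancedD(1,2,5)[OF bal] unfolding A[symmetric] by (simp_all add: image_Un) blast
    ultimately have "balanced (V - A) rest" by (simp add: balanced_def)
    have "contraction V (us @ rest) = contraction A us * (contraction (V - A) rest :: ('l, 'n ugl) tensor_power)"
    proof -
      have "contraction (A \<union> (V - A)) (us @ rest) =
          contraction A us * (contraction (V - A) rest :: ('l, 'n ugl) tensor_power)"
      proof (rule contraction_append)
        show "fst ` set us \<union> col ` set us \<subseteq> A" by (simp add: A A_def)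
        show "fst ` set rest \<union> col ` set rest \<subseteq> V - A"
          using balancedD(5,6)[OF \<open>balanced (V - A) rest\<close>] by simp
      qed simp
      moreover have "A \<union> (V - A) = V"
      proof -
        have "A \<subseteq> V" using balancedD(5)[OF bal] unfolding A[symmetric] by (simp add: image_Un)
        then show ?thesis by blast
      qed
      ultimately show ?thesis by simp
    qed
    moreover have "contraction A us = polarised_trace (map (snd \<circ> snd) us)"
      unfolding A_def using balancedD(3)[OF bal] *(3) by (intro contraction_cycle) simp_all
    then have "(contraction A us :: ('l, 'n ugl) tensor_power) \<in> polarised_trace_algebra"
      unfolding polarised_trace_algebra_def
      using *(1) by (intro subalgebra_generated.gen CollectI exI[of _ "map (snd \<circ> snd) us"]) simp
    moreover have "length rest < length w"
      using mset_eq_length[OF *(2)] *(1) by simp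
    then have "(contraction (V - A) rest :: ('l, 'n ugl) tensor_power) \<in> polarised_trace_algebra"
      using less.hyps \<open>balanced (V - A) rest\<close> by blast
    ultimately have "(contraction V (us @ rest) :: ('l, 'n ugl) tensor_power) \<in> polarised_trace_algebra"
      by (simp add: polarised_trace_algebra_def subalgebra_generated.mult)
    moreover have "(contraction V w - contraction V (us @ rest) :: ('l, 'n ugl) tensor_power) \<in> polarised_trace_algebra"
      unfolding polarised_trace_algebra_def
    proof (rule contraction_perm[OF _ less.prems *(2)])
      fix V' and w' :: "('v \<times> 'v \<times> 'l) list"
      assume "balanced V' w'" "Suc (length w') = length w"
      then show "(contraction V' w' :: ('l, 'n ugl) tensor_power)
          \<in> subalgebra_generated {polarised_trace as |as. as \<noteq> []}"
        using less.hyps unfolding polarised_trace_algebra_def by simp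
    qed
    ultimately have "contraction V (us @ rest) + (contraction V w - contraction V (us @ rest))
        \<in> (polarised_trace_algebra :: ('l, 'n ugl) tensor_power set)"
      unfolding polarised_trace_algebra_def by (rule subalgebra_generated.add)
    then show ?thesis by simp
  qed
qed

section \<open>Polarised traces commute with the diagonal\<close>

lemma polarised_trace_commutes:
  assumes "as \<noteq> []"
  shows "(polarised_trace as :: ('l::finite, 'n::finite ugl) tensor_power) \<in> centraliser (range diagonal)"
proof -
  \<comment> \<open>The positions of \<open>as\<close> serve as variables: letter number
    \<open>k\<close> has column \<open>k\<close>, row \<open>k + 1\<close> taken cyclically and
    label \<open>as ! k\<close>, so \<open>w\<close> is a single cycle.\<close>
  define w where "w = zip (rotate1 [0..<length as]) (zip [0..<length as] as)"
  have rows: "map fst w = rotate1 [0..<length as]" by (simp add: w_def)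
  have snd: "map snd w = zip [0..<length as] as" by (simp add: w_def)
  have "map col w = map fst (map snd w)" by (simp add: col_def)
  then have cols: "map col w = [0..<length as]" unfolding snd by simp
  have "map (snd \<circ> snd) w = map snd (map snd w)" by simp
  then have labels: "map (snd \<circ> snd) w = as" unfolding snd by simp
  have set: "col ` set w = {..<length as}" using arg_cong[OF cols, of set] by auto
  have "balanced {..<length as} w" by (auto simp: balanced_def rows cols mset_rotate1 simp del: mset_map)
  moreover have "contraction {..<length as} w = (polarised_trace as :: ('l, 'n ugl) tensor_power)"
    using contraction_cycle[of w] by (simp add: rows cols labels set)
  ultimately show ?thesis
    using contraction_commutes[where ?'l = 'l and ?'n = 'n, of "{..<length as}" w] by simp
qed

lemma polarised_trace_algebra_commutes:
  assumes "(x :: ('l::finite, 'n::finite ugl) tensor_power) \<in> polarised_trace_algebra"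
  shows "x \<in> centraliser (range diagonal)"
  using assms unfolding polarised_trace_algebra_def
proof (induction rule: subalgebra_generated.induct)
  case (gen x)
  then show ?case using polarised_trace_commutes by blast
next
  case (mult x y)
  show ?case
    unfolding centraliser_def
  proof (intro CollectI ballI)
    fix z assume "z \<in> range (diagonal :: 'n ugl \<Rightarrow> ('l, 'n ugl) tensor_power)"
    then have "x * z = z * x" "y * z = z * y" using mult.IH by (auto simp: centraliser_def)
    then show "x * y * z = z * (x * y)" by (metis mult.assoc)
  qed
qed (simp_all add: centraliser_def distrib_left distrib_right cscale_mult_left cscale_mult_right)

section \<open>Words span the tensor power\<close>

lemma noncomm_eval_mono:
  assumes "d \<le> d'"
  shows "range (noncomm_eval d :: _ \<Rightarrow> ('l::finite, 'n::finite ugl) tensor_power) \<subseteq> range (noncomm_eval d')"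
proof clarify
  fix c :: "('n \<times> 'n \<times> 'l) list \<Rightarrow> complex"
  have "(noncomm_eval d c :: ('l, 'n ugl) tensor_power) =
      noncomm_eval d' (\<lambda>w. if length w \<le> d then c w else 0)"
    unfolding noncomm_eval_def using assms by (intro sum.mono_neutral_cong_left) (auto simp: finite_words)
  then show "(noncomm_eval d c :: ('l, 'n ugl) tensor_power) \<in> range (noncomm_eval d')"
    by (simp only: rangeI)
qed

text \<open>The values form a subalgebra containing all \<open>at_factor a u\<close>; pure tensors
  are products of these, one for each tensor factor, and pure tensors span.\<close>

lemma noncomm_eval_surj: "(x :: ('l::finite, 'n::finite ugl) tensor_power) \<in> (\<Union>d. range (noncomm_eval d))"
proof -
  define F where "F = (\<Union>d. range (noncomm_eval d :: _ \<Rightarrow> ('l, 'n ugl) tensor_power))"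
  have add: "x + y \<in> F" if "x \<in> F" "y \<in> F" for x y
  proof -
    obtain d d' where "x \<in> range (noncomm_eval d)" "y \<in> range (noncomm_eval d')"
      using \<open>x \<in> F\<close> \<open>y \<in> F\<close> unfolding F_def by blast
    then have "x \<in> range (noncomm_eval (max d d'))" "y \<in> range (noncomm_eval (max d d'))"
      using noncomm_eval_mono[of d "max d d'"] noncomm_eval_mono[of d' "max d d'"] by auto
    then obtain f g where "x = noncomm_eval (max d d') f" "y = noncomm_eval (max d d') g" by blast
    then have "x + y = noncomm_eval (max d d') (\<lambda>w. f w + g w)" by (simp add: noncomm_eval_add)
    then show ?thesis unfolding F_def by blast
  qed
  have scale: "c *c x \<in> F" if "x \<in> F" for c x
  proof -
    obtain d f where "x = noncomm_eval d f" using \<open>x \<in> F\<close> unfolding F_def by blast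
    then have "c *c x = noncomm_eval d (\<lambda>w. c * f w)" by (simp add: noncomm_eval_scale)
    then show ?thesis unfolding F_def by blast
  qed
  have mon: "monomial w \<in> F" for w
  proof -
    have "monomial w = noncomm_eval (length w) (\<lambda>v. \<Sum>x\<in>{w}. if v = x then 1 else 0)"
      by (subst noncomm_eval_sum_words) (simp_all add: cscale_one)
    then show ?thesis unfolding F_def by blast
  qed
  have zero: "0 \<in> F" using scale[OF mon, of 0] by simp
  have sum: "(\<Sum>i\<in>I. f i) \<in> F" if "\<And>i. i \<in> I \<Longrightarrow> f i \<in> F" for I :: "'i set" and f
    using that by (induction I rule: infinite_finite_induct) (auto intro: zero add)
  have sum': "(\<Sum>i\<in>I. f i) \<in> F" if "\<And>i. i \<in> I \<Longrightarrow> f i \<in> F" for I :: "'j set" and f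
    using that by (induction I rule: infinite_finite_induct) (auto intro: zero add)
  have mult: "x * y \<in> F" if "x \<in> F" "y \<in> F" for x y
  proof -
    obtain d f d' g where "x = noncomm_eval d f" "y = noncomm_eval d' g"
      using \<open>x \<in> F\<close> \<open>y \<in> F\<close> unfolding F_def by blast
    then have "x * y = (\<Sum>v | length v \<le> d. \<Sum>w | length w \<le> d'. (f v * g w) *c monomial (v @ w))"
      by (simp add: noncomm_eval_def sum_product cscale_mult_left cscale_mult_right cscale_cscale mult.commute)
    also have "\<dots> \<in> F" by (intro sum sum' scale mon)
    finally show ?thesis .
  qed
  have one: "1 \<in> F" using mon[of "[]"] by simp
  have at: "at_factor a u \<in> F" for a u
  proof (induction u rule: ugl_induct)
    case (e p q)
    show ?case using mon[of "[(p, q, a)]"] by (simp add: letter_elem_def)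
  qed (simp_all add: at_factor_simps one add scale mult)
  have pure: "pure_tensor f \<in> F" for f
  proof -
    have "pure_tensor (\<lambda>a. if a \<in> A then f a else 1) \<in> F" if "finite A" for A
      using that
    proof (induction A rule: finite_induct)
      case empty
      then show ?case by (simp add: pure_tensor_one one)
    next
      case (insert a A)
      have "pure_tensor (\<lambda>b. if b \<in> insert a A then f b else 1) =
          at_factor a (f a) * pure_tensor (\<lambda>b. if b \<in> A then f b else 1)"
        unfolding at_factor_def pure_tensor_mult
        using insert.hyps by (auto intro!: arg_cong[of _ _ pure_tensor])
      then show ?case by (simp add: mult at insert.IH)
    qed
    from this[of UNIV] show ?thesis by simp
  qed
  have "abs_tensor_power p \<in> F" for p :: "('l, 'n ugl) family \<Rightarrow>\<^sub>0 complex"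
  proof (induction p rule: monoid_alg_induct)
    case (single m c)
    have "abs_tensor_power (Poly_Mapping.single m c) = c *c pure_tensor (factor m)"
      by (simp add: pure_tensor.abs_eq cscale_tensor_power.abs_eq formal_tensor_def mult_single)
    then show ?case by (simp add: scale pure)
  next
    case (sum p q)
    have "abs_tensor_power (p + q) = abs_tensor_power p + abs_tensor_power q"
      by (simp add: plus_tensor_power.abs_eq)
    then show ?case using sum by (simp add: add)
  qed
  then have "x \<in> F" by (metis Quotient3_abs_rep[OF Quotient3_tensor_power])
  then show ?thesis by (simp add: F_def)
qed

section \<open>The centraliser of the diagonal\<close>

lemma balanced_bij:
  assumes "bij_betw \<beta> {..<n} {..<n}"
  shows "balanced {..<n} (map (\<lambda>i. (i, \<beta> i, a i)) [0..<n])"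
proof -
  let ?w = "map (\<lambda>i. (i, \<beta> i, a i)) [0..<n]"
  have rows: "map fst ?w = [0..<n]" by (simp add: comp_def)
  have cols: "map col ?w = map \<beta> [0..<n]" by (simp add: col_def)
  have "image_mset \<beta> (mset_set {..<n}) = mset_set (\<beta> ` {..<n})"
    using assms by (intro image_mset_mset_set) (simp add: bij_betw_def)
  then have "mset (map \<beta> [0..<n]) = mset [0..<n]"
    using assms by (simp add: bij_betw_def atLeast0LessThan)
  then show ?thesis unfolding balanced_def rows cols by auto
qed

theorem corollary3p1:
  shows "(polarised_trace_algebra :: ('l::finite, 'n::finite ugl) tensor_power set) =
    centraliser (range (diagonal :: 'n ugl \<Rightarrow> ('l, 'n ugl) tensor_power))"
proof (intro equalityI subsetI)
  fix x :: "('l, 'n ugl) tensor_power"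
  assume "x \<in> polarised_trace_algebra"
  then show "x \<in> centraliser (range diagonal)" by (rule polarised_trace_algebra_commutes)
next
  fix x :: "('l, 'n ugl) tensor_power"
  assume x: "x \<in> centraliser (range diagonal)"
  obtain d c where c: "x = noncomm_eval d c" using noncomm_eval_surj[of x] by blast
  let ?Z = "polarised_trace_algebra :: ('l, 'n ugl) tensor_power set"
  define S where "S = {w :: ('n \<times> 'n \<times> 'l) list. length w \<le> d}"
  have fin: "finite S" by (simp add: S_def finite_words)
  \<comment> \<open>\<open>K\<close> consists of coefficient functions, not of elements: it also
    contains every function whose value is 0, that is, the linear relations between words.\<close>
  define K where "K = {k. noncomm_eval d k \<in> ?Z}"
  note Z_closed = subalgebra_generated_zero subalgebra_generated.add subalgebra_generated.scale
  have "\<exists>k\<in>K. \<forall>k'\<in>K. (\<Sum>w\<in>S. (c w - k w) * cnj (k' w)) = 0"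
  proof (rule orthogonal_projection_exists[OF fin])
    show "(\<lambda>_. 0) \<in> K"
      by (simp add: K_def noncomm_eval_zero polarised_trace_algebra_def Z_closed)
    show "(\<lambda>w. f w + g w) \<in> K" if "f \<in> K" "g \<in> K" for f g
      using that by (simp add: K_def noncomm_eval_add polarised_trace_algebra_def Z_closed)
    show "(\<lambda>w. z * f w) \<in> K" if "f \<in> K" for z f
      using that by (simp add: K_def noncomm_eval_scale polarised_trace_algebra_def Z_closed)
  qed
  then obtain k where k: "k \<in> K" "\<And>k'. k' \<in> K \<Longrightarrow> (\<Sum>w\<in>S. (c w - k w) * cnj (k' w)) = 0"
    by blast
  define t where "t w = c w - k w" for w
  have act_null: "f \<in> K" if "noncomm_eval d f = 0" for f
    using that by (simp add: K_def polarised_trace_algebra_def Z_closed)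
  \<comment> \<open>The value of \<open>gl_act r s f\<close> is a commutator with an element of the
    diagonal, hence 0.\<close>
  have act_K: "gl_act r s f \<in> K" if "noncomm_eval d f \<in> centraliser (range diagonal)" for r s f
    using that unfolding commutes_diagonal_iff diagonal_eval_commutator by (blast intro: act_null)
  have "noncomm_eval d k \<in> centraliser (range diagonal)"
    using k(1) by (simp add: K_def polarised_trace_algebra_commutes)
  then have "noncomm_eval d t \<in> centraliser (range diagonal)"
    using x by (simp add: t_def[abs_def] noncomm_eval_diff c centraliser_def algebra_simps)
  then have t_K: "gl_act r s t \<in> K" for r s by (rule act_K)
  have t_inv: "gl_act r s t w = 0" if "w \<in> S" for r s w
  proof (rule sum_cnj_self_eq_zero[OF fin _ that])
    have "(\<Sum>w\<in>S. gl_act r s t w * cnj (gl_act r s t w)) =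
        (\<Sum>w\<in>S. t w * cnj (gl_act s r (gl_act r s t) w))"
      unfolding S_def
      by (rule gl_act_adjoint[of "\<lambda>x y. x * cnj y", symmetric]; unfold_locales)
        (simp_all add: algebra_simps)
    moreover have "gl_act s r (gl_act r s t) \<in> K"
      using t_K[of r s] by (intro act_K polarised_trace_algebra_commutes) (simp add: K_def)
    ultimately show "(\<Sum>w\<in>S. gl_act r s t w * cnj (gl_act r s t w)) = 0"
      using k(2) by (simp add: t_def)
  qed
  have "t w = 0" if "w \<in> S" for w
  proof -
    \<comment> \<open>The action preserves the length and the tensor factor labels of a word. With
      both fixed as those of \<open>w\<close>, \<open>t\<close> becomes a kernel in the row indices
      \<open>p\<close> and the column indices \<open>q\<close>.\<close>
    define n where "n = length w"
    define a where "a i = snd (snd (w ! i))" for i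
    define word where "word p q = map (\<lambda>i. (p i, q i, a i)) [0..<n]" for p q :: "nat \<Rightarrow> 'n"
    have word_S: "word p q \<in> S" for p q using that by (simp add: S_def word_def n_def)
    have "t (word p q) = 0" for p q
    proof (rule invariant_kernel_zero[of "{..<n}" "{..<n}" n "\<lambda>p q. t (word p q)"])
      show "t (word p q) = t (word p' q)" if "\<And>i. i \<in> {..<n} \<Longrightarrow> p i = p' i" for p p' q
        using that by (auto simp: word_def intro!: arg_cong[of _ _ t])
      show "t (word p q) = t (word p q')" if "\<And>i. i \<in> {..<n} \<Longrightarrow> q i = q' i" for p q q'
        using that by (auto simp: word_def intro!: arg_cong[of _ _ t])
      show "(\<Sum>i\<in>{..<n}. if p i = r then t (word (p(i := s)) q) else 0) =
          (\<Sum>j\<in>{..<n}. if q j = s then t (word p (q(j := r))) else 0)" for r s p q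
      proof -
        have "(word p q)[i := (s, snd (word p q ! i))] = word (p(i := s)) q"
          "(word p q)[i := (fst (word p q ! i), r, snd (snd (word p q ! i)))] = word p (q(i := r))"
          if "i < n" for i
          using that by (auto simp: word_def intro!: nth_equalityI simp: nth_list_update)
        then have "gl_act r s t (word p q) =
            (\<Sum>i<n. (if p i = r then t (word (p(i := s)) q) else 0) -
              (if q i = s then t (word p (q(i := r))) else 0))"
          unfolding gl_act_def by (intro sum.cong) (auto simp: word_def)
        then show ?thesis using t_inv[OF word_S] by (simp add: sum_subtractf)
      qed
      show "(\<Sum>p\<in>{..<n} \<rightarrow>\<^sub>E UNIV. t (word p (p \<circ> \<beta>))) = 0"
        if \<beta>: "bij_betw \<beta> {..<n} {..<n}" for \<beta>
      proof -
        let ?P = "{..<n} \<rightarrow>\<^sub>E (UNIV :: 'n set)"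
        have fin_P: "finite ?P" by (simp add: finite_PiE)
        \<comment> \<open>A coefficient function for the contraction attached to
          \<open>\<beta>\<close>; pairing it with \<open>t\<close> gives the required sum.\<close>
        define k' where "k' w = (\<Sum>p\<in>?P. if w = word p (p \<circ> \<beta>) then 1 else 0 :: complex)" for w
        have "noncomm_eval d k' = (\<Sum>p\<in>?P. 1 *c monomial (word p (p \<circ> \<beta>)) :: ('l, 'n ugl) tensor_power)"
          unfolding k'_def using fin_P word_S by (intro noncomm_eval_sum_words) (auto simp: S_def)
        also have "\<dots> = contraction {..<n} (map (\<lambda>i. (i, \<beta> i, a i)) [0..<n])"
          by (simp add: contraction_def instantiate_def word_def cscale_one comp_def)
        finally have "k' \<in> K"
          by (simp add: K_def contraction_in_polarised_trace_algebra balanced_bij[OF \<beta>])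
        have "(\<Sum>w\<in>S. t w * cnj (k' w)) =
            (\<Sum>p\<in>?P. \<Sum>w\<in>S. if w = word p (p \<circ> \<beta>) then t w else 0)"
          by (subst sum.swap) (simp add: k'_def sum_distrib_left if_distrib[of cnj] if_distrib[of "(*) _"] cong: if_cong)
        also have "\<dots> = (\<Sum>p\<in>?P. t (word p (p \<circ> \<beta>)))"
          using word_S by (simp add: fin)
        finally show ?thesis using k(2)[OF \<open>k' \<in> K\<close>] by (simp add: t_def)
      qed
    qed simp_all
    moreover have "w = word (\<lambda>i. fst (w ! i)) (\<lambda>i. fst (snd (w ! i)))"
      by (auto simp: word_def a_def n_def intro!: nth_equalityI)
    ultimately show ?thesis by metis
  qed
  \<comment> \<open>\<open>c\<close> and \<open>k\<close> agree on all words that enter, so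
    \<open>x\<close> is the value of \<open>k\<close>, an element of the algebra.\<close>
  then have "noncomm_eval d c = noncomm_eval d k"
    unfolding noncomm_eval_def by (intro sum.cong) (auto simp: S_def t_def)
  then show "x \<in> ?Z" using k(1) by (simp add: c K_def)
qed

end
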